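(* Let $\lambda\in(0,1)$. If $G$ is the group of symmetries of a regular polytope $P$ in $\mathbb{R}^n$ centered at the origin $o$, and the convex bodies $K$ and $L$ in $\mathbb{R}^n$ are invariant under $G$, then $$V((1-\lambda)\cdot K +_0 \lambda\cdot L)\geq V(K)^{1-\lambda}\, V(L)^\lambda .$$
   Context: A convex body in $\mathbb{R}^n$ is a compact convex set with non-empty interior; $V$ is $n$-dimensional Lebesgue measure. A set $X$ is invariant under $G$ if $gX=X$ for all $g\in G$. The support function of a compact convex set $K$ is $h_K(u)=\max\{\langle u,y\rangle: y\in K\}$. For convex bodies $K,L$ with $o$ in their interiors (automatically the case under the invariance hypothesis of the claim), the $L_0$-sum is $$(1-\lambda)\cdot K+_0\lambda\cdot L=\{x\in\mathbb{R}^n:\langle x,u\rangle\leq h_K(u)^{1-\lambda}h_L(u)^{\lambda}\ \ \forall u\in S^{n-1}\}.$$ *)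

theory Defs
  imports "HOL-Analysis.Analysis"
begin

definition convex_body :: "'a::euclidean_space set \<Rightarrow> bool" where
  "convex_body K \<longleftrightarrow> compact K \<and> convex K \<and> interior K \<noteq> {}"

(* For nonempty compact K the supremum is attained, so Sup is the maximum. *)
definition support_function :: "'a::euclidean_space set \<Rightarrow> 'a \<Rightarrow> real" where
  "support_function K u = (SUP y\<in>K. u \<bullet> y)"

(* Meant for convex bodies with the origin in their interiors, where both support
   functions are positive on the sphere. *)
definition L0_sum :: "real \<Rightarrow> 'a::euclidean_space set \<Rightarrow> 'a set \<Rightarrow> 'a set" where
  "L0_sum t K L = {x. \<forall>u\<in>sphere 0 1.
     x \<bullet> u \<le> support_function K u powr (1 - t) * support_function L u powr t}"

(* Distance-preserving self-maps of a Euclidean space are automatically surjective;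
   they are not assumed linear. *)
definition symmetry_group :: "'a::euclidean_space set \<Rightarrow> ('a \<Rightarrow> 'a) set" where
  "symmetry_group P = {g. (\<forall>x y. dist (g x) (g y) = dist x y) \<and> g ` P = P}"

definition invariant_under :: "('a \<Rightarrow> 'a) set \<Rightarrow> 'a set \<Rightarrow> bool" where
  "invariant_under G X \<longleftrightarrow> (\<forall>g\<in>G. g ` X = X)"

(* Maximal chains in the face lattice; the improper faces {} and P belong to every flag. *)
definition flags :: "'a::euclidean_space set \<Rightarrow> 'a set set set" where
  "flags P = {\<Phi>. subset.maxchain {F. F face_of P} \<Phi>}"

definition regular_polytope :: "'a::euclidean_space set \<Rightarrow> bool" where
  "regular_polytope P \<longleftrightarrow> polytope P \<and> interior P \<noteq> {} \<and>
     (\<forall>\<Phi>\<in>flags P. \<forall>\<Psi>\<in>flags P. \<exists>g\<in>symmetry_group P. (\<lambda>F. g ` F) ` \<Phi> = \<Psi>)"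

(* The centre of a regular polytope is the barycentre of its vertices, here written
   without the normalising factor. *)
definition centered_at_origin :: "'a::euclidean_space set \<Rightarrow> bool" where
  "centered_at_origin P \<longleftrightarrow> (\<Sum>v | v extreme_point_of P. v) = 0"

end

theory Submission
  imports Defs
begin

text \<open>
  The reflections in the symmetry group of a regular polytope form a finite root system that spans
  the space: for a flag and a second flag differing from it in a single face, the symmetry between
  the two flags fixes the vertex sums of all other faces of the first flag, hence is a reflection,
  and the vertex sums of a flag span. Let \<open>C\<close> be a Weyl chamber. Every body invariant under the
  reflections has volume \<open>N V(K \<inter> C)\<close>, where \<open>N\<close> is the number of chambers. The chamber is the
  positive orthant in the coordinates given by the simple roots, and each \<open>u\<close> in its closure is a
  nonnegative combination of simple roots, because these are pairwise obtuse. By Hoelder's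
  inequality the coordinatewise geometric mean of points of \<open>K \<inter> C\<close> and \<open>L \<inter> C\<close> then lies in the
  \<open>L\<^sub>0\<close>-sum, and the claim is the multiplicative form of the Prekopa-Leindler inequality in the
  positive orthant.
\<close>

section \<open>The Prekopa-Leindler inequality\<close>

text \<open>The \<open>L0_sum\<close> is cut out by halfspaces, so a lower bound for its volume
  calls for an operation that turns a point x of K and a point y of L into a point of the sum.
  Hoelder makes the geometric mean such an operation only under two demands: the coordinates are
  positive, and each tested direction u pairs with x as a nonnegative combination of these
  coordinates. A chamber meets both at once, the coordinates being the inner products with the
  simple roots, and the symmetry disposes of all directions outside its closure. For these inner
  products to be coordinates there must be exactly n simple roots, which is why the reflections have
  to span. They do because a flag of P admits a second choice of its face in each dimension 0, ...,
  n - 1, so that regularity yields one reflection per dimension. Centering enters twice: it makes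
  every isometry of P linear, and it makes the vertex sum of P itself vanish, leaving n vertex sums,
  of which each of these n reflections moves exactly one.\<close>

lemma weighted_am_gm:
  fixes a b t :: real
  assumes "0 < t" "t < 1" "0 \<le> a" "0 \<le> b"
  shows "a powr (1 - t) * b powr t \<le> (1 - t) * a + t * b"
proof (cases "a = 0 \<or> b = 0")
  case False
  then show ?thesis using assms by (intro Youngs_inequality_0) auto
qed (use assms in auto)

text \<open>Hoelder with exponents 1/(1-t) and 1/t: once both sums are scaled to 1, it is the
  weighted AM-GM inequality termwise.\<close>

lemma sum_powr_Holder:
  fixes x y :: "'a \<Rightarrow> real"
  assumes t: "0 < t" "t < 1" and nonneg: "\<And>i. i \<in> I \<Longrightarrow> 0 \<le> x i" "\<And>i. i \<in> I \<Longrightarrow> 0 \<le> y i"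
  shows "(\<Sum>i\<in>I. x i powr (1 - t) * y i powr t) \<le> (\<Sum>i\<in>I. x i) powr (1 - t) * (\<Sum>i\<in>I. y i) powr t"
proof (cases "finite I \<and> (\<Sum>i\<in>I. x i) \<noteq> 0 \<and> (\<Sum>i\<in>I. y i) \<noteq> 0")
  case False
  have "(\<Sum>i\<in>I. x i powr (1 - t) * y i powr t) = 0"
  proof (cases "finite I")
    case True
    then have "(\<forall>i\<in>I. x i = 0) \<or> (\<forall>i\<in>I. y i = 0)"
      using False nonneg by (auto simp: sum_nonneg_eq_0_iff)
    then show ?thesis by (intro sum.neutral) auto
  qed auto
  then show ?thesis by simp
next
  case True
  define X Y where "X = (\<Sum>i\<in>I. x i)" and "Y = (\<Sum>i\<in>I. y i)"
  have pos: "0 < X" "0 < Y"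
    using True nonneg unfolding X_def Y_def by (auto simp: less_le sum_nonneg)
  have "(\<Sum>i\<in>I. x i powr (1 - t) * y i powr t)
      = (X powr (1 - t) * Y powr t) * (\<Sum>i\<in>I. (x i / X) powr (1 - t) * (y i / Y) powr t)"
    unfolding sum_distrib_left using pos nonneg by (intro sum.cong) (auto simp: powr_divide)
  also have "\<dots> \<le> (X powr (1 - t) * Y powr t) * (\<Sum>i\<in>I. (1 - t) * (x i / X) + t * (y i / Y))"
    using pos nonneg t by (intro mult_left_mono sum_mono weighted_am_gm) auto
  also have "(\<Sum>i\<in>I. (1 - t) * (x i / X) + t * (y i / Y)) = 1"
    using pos by (simp add: sum.distrib flip: sum_distrib_left sum_divide_distrib X_def Y_def)
  finally show ?thesis by (simp add: X_def Y_def)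
qed

section \<open>The Brunn-Minkowski inequality on the line\<close>

lemma compact_inner_approx:
  fixes A :: "'a::euclidean_space set"
  assumes A: "A \<in> sets borel" and fin: "emeasure lborel A < \<infinity>" and c: "c < emeasure lborel A"
  obtains K where "compact K" "K \<subseteq> A" "c < emeasure lborel K"
proof -
  \<comment> \<open>Restricting Lebesgue measure to \<open>A\<close> makes it finite, as inner
    regularity asks.\<close>
  define M where "M = density lborel (indicator A)"
  have em: "emeasure M B = emeasure lborel (A \<inter> B)" if "B \<in> sets borel" for B
    unfolding M_def using that A by (subst emeasure_density) (auto simp flip: indicator_inter_arith)
  have "emeasure M A = (SUP K \<in> {K. K \<subseteq> A \<and> compact K}. emeasure M K)"
  proof (rule inner_regular)
    show "emeasure M (space M) \<noteq> \<infinity>"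
      using fin em[of UNIV] by (auto simp: M_def)
  qed (use A in \<open>auto simp: M_def\<close>)
  then have "c < (SUP K \<in> {K. K \<subseteq> A \<and> compact K}. emeasure M K)"
    using c em[OF A] by simp
  then obtain K where K: "K \<subseteq> A" "compact K" "c < emeasure M K"
    by (auto simp: less_SUP_iff)
  then have "emeasure M K = emeasure lborel K"
    by (subst em) (auto simp: Int_absorb1 borel_compact)
  then show ?thesis using K that by auto
qed

lemma emeasure_lborel_image_affine:
  fixes a c :: real
  assumes "0 < a" and A: "A \<in> sets borel"
  shows "(\<lambda>x. a * x + c) ` A \<in> sets borel"
    and "emeasure lborel ((\<lambda>x. a * x + c) ` A) = ennreal a * emeasure lborel A"
proof -
  have eq: "(\<lambda>x. a * x + c) ` A = (\<lambda>x. (1/a) * x + (- c / a)) -` A"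
    using assms by (force simp: field_simps image_iff)
  show m: "(\<lambda>x. a * x + c) ` A \<in> sets borel"
    unfolding eq using measurable_sets[of "\<lambda>x. (1/a) * x + (- c / a)" borel borel A] A by simp
  have "emeasure lborel ((\<lambda>x. a * x + c) ` A) = (\<integral>\<^sup>+x. indicator ((\<lambda>x. a * x + c) ` A) x \<partial>lborel)"
    using m by simp
  also have "\<dots> = ennreal a * (\<integral>\<^sup>+x. indicator ((\<lambda>x. a * x + c) ` A) (c + a * x) \<partial>lborel)"
    using m assms by (subst nn_integral_real_affine[where c=a and t=c]) (auto simp: nn_integral_cmult)
  also have "(\<lambda>x. indicator ((\<lambda>x. a * x + c) ` A) (c + a * x)) = (indicator A :: real \<Rightarrow> ennreal)"
    using assms by (auto simp: fun_eq_iff indicator_def image_iff)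
  finally show "emeasure lborel ((\<lambda>x. a * x + c) ` A) = ennreal a * emeasure lborel A"
    using A by simp
qed

text \<open>The translates A + min B and B + max A both lie in \<open>C\<close>, and they meet only
  in the point max A + min B.\<close>

lemma brunn_minkowski_real_compact:
  fixes A B C :: "real set"
  assumes A: "compact A" "A \<noteq> {}" and B: "compact B" "B \<noteq> {}" and C: "C \<in> sets borel"
    and sum: "\<And>a b. a \<in> A \<Longrightarrow> b \<in> B \<Longrightarrow> a + b \<in> C"
  shows "emeasure lborel A + emeasure lborel B \<le> emeasure lborel C"
proof -
  obtain p where p: "p \<in> A" "\<And>x. x \<in> A \<Longrightarrow> x \<le> p" using compact_attains_sup[OF A] by auto
  obtain q where q: "q \<in> B" "\<And>x. x \<in> B \<Longrightarrow> q \<le> x" using compact_attains_inf[OF B] by auto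
  have bA: "A \<in> sets borel" and bB: "B \<in> sets borel" using A B by (auto simp: borel_compact)
  define A' where "A' = (\<lambda>x. 1 * x + q) ` A"
  define B' where "B' = (\<lambda>x. 1 * x + p) ` B"
  have A': "A' \<in> sets borel" "emeasure lborel A' = emeasure lborel A"
    and B': "B' \<in> sets borel" "emeasure lborel B' = emeasure lborel B"
    using emeasure_lborel_image_affine[of 1] bA bB unfolding A'_def B'_def by auto
  have B'': "emeasure lborel (B' - {p + q}) = emeasure lborel B'"
    by (intro emeasure_Diff_null_set) (auto simp: B')
  have "A' \<inter> (B' - {p + q}) = {}"
  proof (rule equals0I)
    fix x assume "x \<in> A' \<inter> (B' - {p + q})"
    then obtain a b where "a \<in> A" "b \<in> B" "x = a + q" "x = b + p" "x \<noteq> p + q"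
      by (auto simp: A'_def B'_def)
    then show False using p(2)[of a] q(2)[of b] by linarith
  qed
  then have "emeasure lborel A' + emeasure lborel (B' - {p + q}) = emeasure lborel (A' \<union> (B' - {p + q}))"
    using A' B' by (intro plus_emeasure) auto
  also have "\<dots> \<le> emeasure lborel C"
    using C sum p(1) q(1) by (intro emeasure_mono) (auto simp: A'_def B'_def add.commute[of _ p])
  finally show ?thesis by (simp add: A' B' B'')
qed

text \<open>Follows from the compact case by inner regularity. Taking for \<open>C\<close> any Borel
  set that contains the combinations avoids the question whether a Minkowski sum of Borel sets is
  Borel.\<close>

lemma brunn_minkowski_real:
  fixes A B C :: "real set"
  assumes t: "0 < t" "t < 1"
    and A: "A \<in> sets borel" "A \<noteq> {}" "emeasure lborel A < \<infinity>"
    and B: "B \<in> sets borel" "B \<noteq> {}" "emeasure lborel B < \<infinity>"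
    and C: "C \<in> sets borel"
    and sum: "\<And>a b. a \<in> A \<Longrightarrow> b \<in> B \<Longrightarrow> (1 - t) * a + t * b \<in> C"
  shows "ennreal (1 - t) * emeasure lborel A + ennreal t * emeasure lborel B \<le> emeasure lborel C"
proof -
  \<comment> \<open>The compact case takes a maximum and a minimum, so the supremum runs over
    nonempty sets only; a set of measure above \<open>c\<close> is nonempty anyway.\<close>
  have inner: "emeasure lborel A \<le> (SUP K \<in> {K. K \<subseteq> A \<and> compact K \<and> K \<noteq> {}}. emeasure lborel K)"
    if A: "A \<in> sets borel" "A \<noteq> {}" "emeasure lborel A < \<infinity>" for A :: "real set"
  proof (rule dense_le)
    fix c assume "c < emeasure lborel A"
    then obtain K where K: "compact K" "K \<subseteq> A" "c < emeasure lborel K"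
      using compact_inner_approx[OF A(1,3)] by blast
    then have "K \<noteq> {}" by auto
    then have "emeasure lborel K \<le> (SUP K \<in> {K. K \<subseteq> A \<and> compact K \<and> K \<noteq> {}}. emeasure lborel K)"
      using K by (intro SUP_upper) auto
    then show "c \<le> (SUP K \<in> {K. K \<subseteq> A \<and> compact K \<and> K \<noteq> {}}. emeasure lborel K)"
      using K by (meson dual_order.trans less_imp_le)
  qed
  have *: "ennreal (1 - t) * emeasure lborel K + ennreal t * emeasure lborel L \<le> emeasure lborel C"
    if "K \<subseteq> A" "compact K" "K \<noteq> {}" "L \<subseteq> B" "compact L" "L \<noteq> {}" for K L
  proof -
    \<comment> \<open>The summand 0 keeps the shape of
      \<open>emeasure_lborel_image_affine\<close>.\<close>
    have cK: "compact ((\<lambda>x. (1 - t) * x + 0) ` K)" "compact ((\<lambda>x. t * x + 0) ` L)"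
      using that by (auto intro!: compact_continuous_image continuous_intros)
    have "emeasure lborel ((\<lambda>x. (1 - t) * x + 0) ` K) + emeasure lborel ((\<lambda>x. t * x + 0) ` L)
        \<le> emeasure lborel C"
      using that sum by (intro brunn_minkowski_real_compact cK C) auto
    then show ?thesis
      using that t by (simp add: emeasure_lborel_image_affine(2) borel_compact del: add_0_right)
  qed
  let ?SA = "{K. K \<subseteq> A \<and> compact K \<and> K \<noteq> {}}" and ?SB = "{K. K \<subseteq> B \<and> compact K \<and> K \<noteq> {}}"
  have "?SA \<noteq> {}" "?SB \<noteq> {}"
    using A(2) B(2) by (auto intro: exI[of _ "{x}" for x])
  have "ennreal (1 - t) * emeasure lborel A + ennreal t * emeasure lborel B
     \<le> ennreal (1 - t) * (SUP K \<in> ?SA. emeasure lborel K) + ennreal t * (SUP K \<in> ?SB. emeasure lborel K)"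
    using inner[OF A] inner[OF B] by (intro add_mono mult_left_mono) auto
  also have "\<dots> = (SUP K \<in> ?SA. ennreal (1 - t) * emeasure lborel K) + (SUP K \<in> ?SB. ennreal t * emeasure lborel K)"
    by (simp add: SUP_mult_left_ennreal)
  also have "\<dots> = (SUP K \<in> ?SA. SUP L \<in> ?SB. ennreal (1 - t) * emeasure lborel K + ennreal t * emeasure lborel L)"
    using \<open>?SA \<noteq> {}\<close> \<open>?SB \<noteq> {}\<close>
    by (subst ennreal_SUP_add_left[symmetric]) (auto simp: ennreal_SUP_add_right intro!: SUP_cong)
  also have "\<dots> \<le> emeasure lborel C"
    using * by (intro SUP_least) auto
  finally show ?thesis .
qed

section \<open>The Prekopa-Leindler inequality on the line\<close>

lemma nn_integral_layer_cake:
  fixes f :: "real \<Rightarrow> real"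
  assumes [measurable]: "f \<in> borel_measurable borel" 
  shows "(\<integral>\<^sup>+x. ennreal (f x) \<partial>lborel)
    = (\<integral>\<^sup>+s. indicator {0..} s * emeasure lborel {x. s < f x} \<partial>lborel)"
proof -
  have "(\<integral>\<^sup>+x. ennreal (f x) \<partial>lborel) = (\<integral>\<^sup>+x. (\<integral>\<^sup>+s. indicator {0..} s * (if s < f x then 1 else 0) \<partial>lborel) \<partial>lborel)"
  proof (rule nn_integral_cong)
    fix x :: real
    \<comment> \<open>Negative values of \<open>f\<close> disappear on both sides:
      \<open>ennreal\<close> sends them to 0, and the interval from 0 to \<open>f x\<close> is then
      empty.\<close>
    have "(\<integral>\<^sup>+s. indicator {0..} s * (if s < f x then 1 else 0) \<partial>lborel) = (\<integral>\<^sup>+s. indicator {0..<f x} s \<partial>lborel)"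
      by (intro nn_integral_cong) (auto simp: indicator_def)
    also have "\<dots> = ennreal (f x)"
      by (cases "0 \<le> f x") (auto simp: ennreal_neg)
    finally show "ennreal (f x) = (\<integral>\<^sup>+s. indicator {0..} s * (if s < f x then 1 else 0) \<partial>lborel)" ..
  qed
  also have "\<dots> = (\<integral>\<^sup>+s. (\<integral>\<^sup>+x. indicator {0..} s * (if s < f x then 1 else 0) \<partial>lborel) \<partial>lborel)"
    by (rule lborel_pair.Fubini') simp
  also have "\<dots> = (\<integral>\<^sup>+s. indicator {0..} s * emeasure lborel {x. s < f x} \<partial>lborel)"
  proof (rule nn_integral_cong)
    fix s :: real
    have "(\<integral>\<^sup>+x. (if s < f x then 1 else 0) \<partial>lborel) = (\<integral>\<^sup>+x. indicator {x. s < f x} x \<partial>lborel)"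
      by (intro nn_integral_cong) (auto simp: indicator_def)
    then show "(\<integral>\<^sup>+x. indicator {0..} s * (if s < f x then 1 else 0) \<partial>lborel) = indicator {0..} s * emeasure lborel {x. s < f x}"
      by (subst nn_integral_cmult) auto
  qed
  finally show ?thesis .
qed

text \<open>With both suprema equal to 1, the superlevel sets of \<open>f\<close> and
  \<open>g\<close> are nonempty for the same levels s < 1, so Brunn-Minkowski applies at every level
  and integrates to an arithmetic mean. Without this normalisation one of the two sets could be
  empty while the other is not.\<close>

lemma prekopa_leindler_real_normalized:
  fixes f g h :: "real \<Rightarrow> real"
  assumes t: "0 < t" "t < 1"
    and [measurable]: "f \<in> borel_measurable borel" "g \<in> borel_measurable borel" "h \<in> borel_measurable borel"
    and int: "integrable lborel f" "integrable lborel g" "integrable lborel h"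
    and nonneg: "\<And>x. 0 \<le> f x" "\<And>x. 0 \<le> g x" "\<And>x. 0 \<le> h x"
    and le1: "\<And>x. f x \<le> 1" "\<And>x. g x \<le> 1"
    and sup1: "\<And>s. s < 1 \<Longrightarrow> \<exists>x. s < f x" "\<And>s. s < 1 \<Longrightarrow> \<exists>x. s < g x"
    and ineq: "\<And>x y. f x powr (1 - t) * g y powr t \<le> h ((1 - t) * x + t * y)"
  shows "(1 - t) * integral\<^sup>L lborel f + t * integral\<^sup>L lborel g \<le> integral\<^sup>L lborel h"
proof -
  have fin: "emeasure lborel {x. s < u x} < \<infinity>" if "integrable lborel u" "0 < s" "\<And>x. 0 \<le> u x" for u and s :: real
  proof -
    have "emeasure lborel {x \<in> space lborel. s \<le> u x} < \<infinity>"
      by (rule order.strict_trans1[OF integral_Markov_inequality[OF that(1) _ that(2)]]) (use that in auto)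
    moreover have "emeasure lborel {x. s < u x} \<le> emeasure lborel {x \<in> space lborel. s \<le> u x}"
      using borel_measurable_integrable[OF that(1)] by (intro emeasure_mono) auto
    ultimately show ?thesis by (rule order.strict_trans1[rotated])
  qed
  have "ennreal ((1 - t) * integral\<^sup>L lborel f + t * integral\<^sup>L lborel g)
      = ennreal (1 - t) * (\<integral>\<^sup>+x. ennreal (f x) \<partial>lborel) + ennreal t * (\<integral>\<^sup>+x. ennreal (g x) \<partial>lborel)"
    using t int nonneg by (simp add: nn_integral_eq_integral ennreal_mult)
  also have "\<dots> = (\<integral>\<^sup>+s. indicator {0..} s * (ennreal (1 - t) * emeasure lborel {x. s < f x} + ennreal t * emeasure lborel {x. s < g x}) \<partial>lborel)"
    by (simp add: nn_integral_layer_cake nn_integral_add nn_integral_cmult distrib_left mult.left_commute)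
  also have "\<dots> \<le> (\<integral>\<^sup>+s. indicator {0..} s * emeasure lborel {x. s < h x} \<partial>lborel)"
  \<comment> \<open>The level 0 is discarded because Markov's inequality gives finite measure only
    for superlevel sets at positive levels.\<close>
  proof (rule nn_integral_mono_AE, rule AE_mp[OF AE_lborel_singleton[of 0]], rule AE_I2, rule impI)
    fix s :: real assume "s \<noteq> 0"
    consider "s < 0" | "0 < s" "s < 1" | "1 \<le> s" using \<open>s \<noteq> 0\<close> by linarith
    then show "indicator {0..} s * (ennreal (1 - t) * emeasure lborel {x. s < f x} + ennreal t * emeasure lborel {x. s < g x})
        \<le> indicator {0..} s * emeasure lborel {x. s < h x}"
    proof cases
      case 2
      have "ennreal (1 - t) * emeasure lborel {x. s < f x} + ennreal t * emeasure lborel {x. s < g x}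
        \<le> emeasure lborel {x. s < h x}"
      proof (rule brunn_minkowski_real[OF t])
        fix a b assume "a \<in> {x. s < f x}" "b \<in> {x. s < g x}"
        then have "s powr (1 - t) * s powr t < f a powr (1 - t) * g b powr t"
          using 2 t by (intro mult_strict_mono powr_less_mono2) auto
        then show "(1 - t) * a + t * b \<in> {x. s < h x}"
          using ineq[of a b] 2 by (simp flip: powr_add)
      qed (use 2 sup1 fin int nonneg in auto)
      then show ?thesis by (intro mult_left_mono) auto
    next
      case 3
      then have "{x. s < f x} = {}" "{x. s < g x} = {}" using le1 by (auto simp: not_less intro: order_trans)
      then show ?thesis by simp
    qed auto
  qed
  also have "\<dots> = ennreal (integral\<^sup>L lborel h)"
    using int nonneg by (simp add: nn_integral_layer_cake[symmetric] nn_integral_eq_integral)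
  finally show ?thesis by (subst (asm) ennreal_le_iff) (auto intro!: Bochner_Integration.integral_nonneg nonneg)
qed

text \<open>Dividing by the suprema reduces to the normalised case, whose arithmetic mean dominates
  the geometric mean that is wanted. A vanishing supremum means a vanishing function.\<close>

lemma prekopa_leindler_real:
  fixes f g h :: "real \<Rightarrow> real"
  assumes t: "0 < t" "t < 1"
    and [measurable]: "f \<in> borel_measurable borel" "g \<in> borel_measurable borel" "h \<in> borel_measurable borel"
    and int: "integrable lborel f" "integrable lborel g" "integrable lborel h"
    and nonneg: "\<And>x. 0 \<le> f x" "\<And>x. 0 \<le> g x" "\<And>x. 0 \<le> h x"
    and bdd: "\<And>x. f x \<le> M" "\<And>x. g x \<le> M"
    and ineq: "\<And>x y. f x powr (1 - t) * g y powr t \<le> h ((1 - t) * x + t * y)"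
  shows "integral\<^sup>L lborel f powr (1 - t) * integral\<^sup>L lborel g powr t \<le> integral\<^sup>L lborel h"
proof -
  have bf: "bdd_above (range f)" and bg: "bdd_above (range g)" using bdd by (auto simp: bdd_above_def)
  define a where "a = Sup (range f)"
  define b where "b = Sup (range g)"
  have fa: "f x \<le> a" and gb: "g x \<le> b" for x unfolding a_def b_def using bf bg by (auto intro: cSUP_upper)
  have h0: "0 \<le> integral\<^sup>L lborel h" using nonneg by simp
  show ?thesis
  proof (cases "a = 0 \<or> b = 0")
    case True
    then have "f = (\<lambda>_. 0) \<or> g = (\<lambda>_. 0)" using fa gb nonneg by (metis antisym ext)
    then show ?thesis using h0 t by auto
  next
    case False
    moreover have "0 \<le> a" "0 \<le> b" using fa[of 0] gb[of 0] nonneg[of 0] by linarith+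
    ultimately have pos: "0 < a" "0 < b" by auto
    \<comment> \<open>The factor that the hypothesis forces on \<open>h\<close> when
      \<open>f\<close> is divided by \<open>a\<close> and \<open>g\<close> by
      \<open>b\<close>.\<close>
    define c where "c = a powr (1 - t) * b powr t"
    have c: "0 < c" using pos by (simp add: c_def)
    have "(1 - t) * integral\<^sup>L lborel (\<lambda>x. f x / a) + t * integral\<^sup>L lborel (\<lambda>x. g x / b) \<le> integral\<^sup>L lborel (\<lambda>x. h x / c)"
    proof (rule prekopa_leindler_real_normalized[OF t])
      fix x y
      have "(f x / a) powr (1 - t) * (g y / b) powr t = f x powr (1 - t) * g y powr t / c"
        using pos nonneg by (simp add: powr_divide c_def)
      also have "\<dots> \<le> h ((1 - t) * x + t * y) / c"
        using ineq c by (intro divide_right_mono) auto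
      finally show "(f x / a) powr (1 - t) * (g y / b) powr t \<le> h ((1 - t) * x + t * y) / c" .
    next
      fix s :: real assume "s < 1"
      then have "s * a < Sup (range f)" "s * b < Sup (range g)" using pos by (auto simp flip: a_def b_def)
      then show "\<exists>x. s < f x / a" "\<exists>x. s < g x / b"
        using bf bg pos by (auto simp: less_cSUP_iff field_simps)
    qed (use pos c nonneg int fa gb in \<open>auto simp: divide_le_eq_1\<close>)
    then have "((1 - t) * (integral\<^sup>L lborel f / a) + t * (integral\<^sup>L lborel g / b)) * c \<le> integral\<^sup>L lborel h"
      using c by (simp add: field_simps)
    moreover have "(integral\<^sup>L lborel f / a) powr (1 - t) * (integral\<^sup>L lborel g / b) powr t
       \<le> (1 - t) * (integral\<^sup>L lborel f / a) + t * (integral\<^sup>L lborel g / b)"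
      using t pos nonneg by (intro weighted_am_gm) auto
    moreover have "integral\<^sup>L lborel f powr (1 - t) * integral\<^sup>L lborel g powr t
       = (integral\<^sup>L lborel f / a) powr (1 - t) * (integral\<^sup>L lborel g / b) powr t * c"
      using pos nonneg by (simp add: powr_divide c_def)
    ultimately show ?thesis using c by (smt (verit) mult_right_mono)
  qed
qed


section \<open>From arithmetic to geometric means, and to several variables\<close>

lemma exp_substitution:
  fixes f :: "real \<Rightarrow> real"
  assumes [measurable]: "f \<in> borel_measurable borel" and int: "integrable lborel f"
    and zero: "\<And>x. x \<le> 0 \<Longrightarrow> f x = 0"
  shows "integrable lborel (\<lambda>s. exp s * f (exp s))"
    and "integral\<^sup>L lborel (\<lambda>s. exp s * f (exp s)) = integral\<^sup>L lborel f"
proof -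
  have ind: "(\<lambda>x. indicator {0<..} x *\<^sub>R f x) = f"
    using zero by (auto simp: fun_eq_iff indicator_def)
  have range: "exp ` UNIV = {0::real<..}" by (auto simp: image_iff) (metis exp_ln)
  have "integrable lebesgue f" using int by (simp add: integrable_completion)
  then have f: "f absolutely_integrable_on exp ` UNIV"
    unfolding range set_integrable_def ind .
  have "(\<lambda>s. \<bar>exp s\<bar> * f (exp s)) absolutely_integrable_on UNIV \<and>
      integral UNIV (\<lambda>s. \<bar>exp s\<bar> * f (exp s)) = integral (exp ` UNIV) f"
    using f by (subst has_absolute_integral_change_of_variables_1') (auto intro!: derivative_eq_intros inj_onI)
  then have i: "(\<lambda>s. exp s * f (exp s)) absolutely_integrable_on UNIV"
    and e: "integral UNIV (\<lambda>s. exp s * f (exp s)) = integral (exp ` UNIV) f" by auto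
  from i show int': "integrable lborel (\<lambda>s. exp s * f (exp s))"
    by (simp add: set_integrable_def integrable_completion)
  have "integral\<^sup>L lborel (\<lambda>s. exp s * f (exp s)) = integral UNIV (\<lambda>s. exp s * f (exp s))"
    using set_lebesgue_integral_eq_integral(2)[OF i]
    by (simp add: set_lebesgue_integral_def integral_completion)
  also have "\<dots> = integral (exp ` UNIV) f" by (rule e)
  also have "\<dots> = integral\<^sup>L lborel f"
    using set_lebesgue_integral_eq_integral(2)[OF f] unfolding range set_lebesgue_integral_def ind
    by (simp add: integral_completion)
  finally show "integral\<^sup>L lborel (\<lambda>s. exp s * f (exp s)) = integral\<^sup>L lborel f" .
qed

text \<open>The substitution x = exp s turns geometric means of arguments into arithmetic means, and
  its Jacobian exp s satisfies the Prekopa-Leindler hypothesis with equality. Hence the additive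
  inequality applies to exp s * f (exp s) and its analogues.\<close>

lemma prekopa_leindler_real_mult:
  fixes f g h :: "real \<Rightarrow> real"
  assumes t: "0 < t" "t < 1"
    and [measurable]: "f \<in> borel_measurable borel" "g \<in> borel_measurable borel" "h \<in> borel_measurable borel"
    and nonneg: "\<And>x. 0 \<le> f x" "\<And>x. 0 \<le> g x" "\<And>x. 0 \<le> h x"
    and bdd: "\<And>x. f x \<le> M" "\<And>x. g x \<le> M" "\<And>x. h x \<le> M"
    and supp: "\<And>x. x \<notin> {0<..R} \<Longrightarrow> f x = 0" "\<And>x. x \<notin> {0<..R} \<Longrightarrow> g x = 0" "\<And>x. x \<notin> {0<..R} \<Longrightarrow> h x = 0"
    and ineq: "\<And>x y. x \<in> {0<..R} \<Longrightarrow> y \<in> {0<..R} \<Longrightarrow> f x powr (1 - t) * g y powr t \<le> h (x powr (1 - t) * y powr t)"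
  shows "integral\<^sup>L lborel f powr (1 - t) * integral\<^sup>L lborel g powr t \<le> integral\<^sup>L lborel h"
proof -
  have supp': "\<forall>x. x \<notin> {0<..R} \<longrightarrow> f x = 0" "\<forall>x. x \<notin> {0<..R} \<longrightarrow> g x = 0" "\<forall>x. x \<notin> {0<..R} \<longrightarrow> h x = 0"
    using supp by blast+
  have int: "integrable lborel u"
    if "u \<in> borel_measurable borel" "\<And>x. 0 \<le> u x" "\<And>x. u x \<le> M" "\<forall>x. x \<notin> {0<..R} \<longrightarrow> u x = 0" for u
  proof (rule integrableI_bounded_set[of "{0<..R}" _ _ M])
    show "emeasure lborel {0<..R} < \<infinity>"
      by (cases "0 \<le> R") auto
    show "AE x in lborel. x \<in> {0<..R} \<longrightarrow> norm (u x) \<le> M" "AE x in lborel. x \<notin> {0<..R} \<longrightarrow> u x = 0"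
      using that(2-4) by (intro AE_I2; simp)+
  qed (use that(1) in auto)
  note int = int[OF assms(3) nonneg(1) bdd(1) supp'(1)] int[OF assms(4) nonneg(2) bdd(2) supp'(2)]
    int[OF assms(5) nonneg(3) bdd(3) supp'(3)]
  \<comment> \<open>The Jacobian is unbounded, but the support in \<open>{0<..R}\<close> caps it by
    \<open>R\<close>. The absolute value covers a nonpositive \<open>R\<close>, where all functions
    vanish.\<close>
  have le: "exp s * u (exp s) \<le> \<bar>R\<bar> * M"
    if "\<And>x. 0 \<le> u x" "\<And>x. u x \<le> M" "\<forall>x. x \<notin> {0<..R} \<longrightarrow> u x = 0" for u and s :: real
  proof (cases "exp s \<le> R")
    case True
    then show ?thesis using that(1,2) by (intro mult_mono) auto
  next
    case False
    then show ?thesis using that(3) that(1,2)[of 0] by simp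
  qed
  have "integral\<^sup>L lborel (\<lambda>s. exp s * f (exp s)) powr (1 - t) * integral\<^sup>L lborel (\<lambda>s. exp s * g (exp s)) powr t
     \<le> integral\<^sup>L lborel (\<lambda>s. exp s * h (exp s))"
  proof (rule prekopa_leindler_real[OF t, where M = "\<bar>R\<bar> * M"])
    fix x y :: real
    have eq: "exp ((1 - t) * x + t * y) = exp x powr (1 - t) * exp y powr t"
      by (simp add: powr_def exp_add)
    have "f (exp x) powr (1 - t) * g (exp y) powr t \<le> h (exp x powr (1 - t) * exp y powr t)"
    proof (cases "exp x \<in> {0<..R} \<and> exp y \<in> {0<..R}")
      case True then show ?thesis using ineq by blast
    next
      case False
      then have "f (exp x) = 0 \<or> g (exp y) = 0" using supp(1,2) by blast
      then show ?thesis using nonneg(3) by auto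
    qed
    then have "(exp x powr (1 - t) * exp y powr t) * (f (exp x) powr (1 - t) * g (exp y) powr t)
       \<le> (exp x powr (1 - t) * exp y powr t) * h (exp x powr (1 - t) * exp y powr t)"
      by (intro mult_left_mono) auto
    then show "(exp x * f (exp x)) powr (1 - t) * (exp y * g (exp y)) powr t
       \<le> exp ((1 - t) * x + t * y) * h (exp ((1 - t) * x + t * y))"
      unfolding eq by (simp only: powr_mult mult.assoc mult.left_commute)
  next
    show "integrable lborel (\<lambda>s. exp s * f (exp s))" "integrable lborel (\<lambda>s. exp s * g (exp s))"
      "integrable lborel (\<lambda>s. exp s * h (exp s))"
      using int supp by (intro exp_substitution(1); simp)+
    show "exp s * f (exp s) \<le> \<bar>R\<bar> * M" "exp s * g (exp s) \<le> \<bar>R\<bar> * M" for s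
      by (rule le nonneg bdd supp')+
  qed (simp_all add: nonneg)
  moreover have "integral\<^sup>L lborel (\<lambda>s. exp s * f (exp s)) = integral\<^sup>L lborel f"
    "integral\<^sup>L lborel (\<lambda>s. exp s * g (exp s)) = integral\<^sup>L lborel g"
    "integral\<^sup>L lborel (\<lambda>s. exp s * h (exp s)) = integral\<^sup>L lborel h"
    using int supp by (intro exp_substitution(2); simp)+
  ultimately show ?thesis by simp
qed

text \<open>Induction on the number of coordinates: integrating out one coordinate gives functions
  of the remaining ones that satisfy the same hypothesis, by the one-dimensional inequality on
  sections. The box \<open>{0<..R}\<close> and the bound \<open>M\<close> keep all these integrals
  finite.\<close>

lemma prekopa_leindler_PiM_mult:
  fixes f g h :: "('i \<Rightarrow> real) \<Rightarrow> real"
  assumes t: "0 < t" "t < 1" and "finite I" and "0 < R" and "0 \<le> M"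
    and "f \<in> borel_measurable (PiM I (\<lambda>_. lborel))" "g \<in> borel_measurable (PiM I (\<lambda>_. lborel))"
      "h \<in> borel_measurable (PiM I (\<lambda>_. lborel))"
    and "\<And>x. 0 \<le> f x" "\<And>x. 0 \<le> g x" "\<And>x. 0 \<le> h x"
    and "\<And>x. f x \<le> M" "\<And>x. g x \<le> M" "\<And>x. h x \<le> M"
    and "\<And>x i. i \<in> I \<Longrightarrow> x i \<notin> {0<..R} \<Longrightarrow> f x = 0" "\<And>x i. i \<in> I \<Longrightarrow> x i \<notin> {0<..R} \<Longrightarrow> g x = 0"
      "\<And>x i. i \<in> I \<Longrightarrow> x i \<notin> {0<..R} \<Longrightarrow> h x = 0"
    and "\<And>x y. x \<in> I \<rightarrow>\<^sub>E {0<..R} \<Longrightarrow> y \<in> I \<rightarrow>\<^sub>E {0<..R} \<Longrightarrow>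
       f x powr (1 - t) * g y powr t \<le> h (\<lambda>i\<in>I. x i powr (1 - t) * y i powr t)"
  shows "integral\<^sup>L (PiM I (\<lambda>_. lborel)) f powr (1 - t) * integral\<^sup>L (PiM I (\<lambda>_. lborel)) g powr t
     \<le> integral\<^sup>L (PiM I (\<lambda>_. lborel)) h"
  using assms(3-)
proof (induction I arbitrary: f g h M rule: finite_induct)
  case empty
  interpret product_sigma_finite "\<lambda>_::'i. lborel :: real measure" ..
  \<comment> \<open>The empty product is a point mass at the only extensional function, which is
    \<open>undefined\<close> everywhere.\<close>
  have "integral\<^sup>L (PiM {} (\<lambda>_. lborel :: real measure)) u = u (\<lambda>_. undefined)" for u :: "('i \<Rightarrow> real) \<Rightarrow> real"
    by (simp add: PiM_empty lebesgue_integral_count_space_finite)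
  then show ?case using empty(15)[of "\<lambda>_. undefined" "\<lambda>_. undefined"] by (simp add: restrict_def)
next
  case (insert i I)
  interpret product_sigma_finite "\<lambda>_::'i. lborel :: real measure" ..
  interpret I: finite_product_sigma_finite "\<lambda>_::'i. lborel :: real measure" I by standard fact
  let ?P = "PiM I (\<lambda>_. lborel :: real measure)" and ?Q = "PiM (insert i I) (\<lambda>_. lborel :: real measure)"
  let ?sec = "\<lambda>u x. (\<integral>s. u (x(i := s)) \<partial>lborel)"
  have sec: "(\<lambda>x. ?sec u x) \<in> borel_measurable ?P" "\<And>x. 0 \<le> ?sec u x" "\<And>x. ?sec u x \<le> M * R"
      "\<And>x j. j \<in> I \<Longrightarrow> x j \<notin> {0<..R} \<Longrightarrow> ?sec u x = 0"
      "\<And>x. x \<in> space ?P \<Longrightarrow> (\<lambda>s. u (x(i := s))) \<in> borel_measurable borel"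
      "integral\<^sup>L ?Q u = integral\<^sup>L ?P (?sec u)"
    if [measurable]: "u \<in> borel_measurable ?Q" and nn: "\<And>x. 0 \<le> u x" and b: "\<And>x. u x \<le> M"
      and supp: "\<forall>x. \<forall>j\<in>insert i I. x j \<notin> {0<..R} \<longrightarrow> u x = 0" for u
  proof -
    have s: "u x = 0" if "j \<in> insert i I" "x j \<notin> {0<..R}" for x j
      using supp that by blast
    have m: "(\<lambda>(x, y). u (x(i := y))) \<in> borel_measurable (?P \<Otimes>\<^sub>M lborel)"
      by measurable
    show "(\<lambda>x. ?sec u x) \<in> borel_measurable ?P"
      using m by (intro lborel.borel_measurable_lebesgue_integral) auto
    show "0 \<le> ?sec u x" for x using nn by simp
    show "?sec u x \<le> M * R" for x
    proof -
      have "?sec u x \<le> (\<integral>s. M * indicator {0<..R} s \<partial>lborel)"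
      proof (rule integral_mono')
        show "integrable lborel (\<lambda>s. M * indicat_real {0<..R} s)"
          using \<open>0 < R\<close> by (auto intro!: integrable_mult_right integrable_real_indicator)
        show "u (x(i := s)) \<le> M * indicator {0<..R} s" for s
          using b[of "x(i := s)"] s[of i "x(i := s)"] by (auto simp: indicator_def)
      qed (use \<open>0 \<le> M\<close> in auto)
      also have "\<dots> = M * R" using \<open>0 < R\<close> by simp
      finally show ?thesis .
    qed
    show "?sec u x = 0" if "j \<in> I" "x j \<notin> {0<..R}" for x j
    proof -
      have "u (x(i := s)) = 0" for s
        using that insert(2) by (intro s[of j]) auto
      then show ?thesis by simp
    qed
    show "(\<lambda>s. u (x(i := s))) \<in> borel_measurable borel" if "x \<in> space ?P" for x
      using measurable_Pair2[OF m that] by simp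
    have "integrable ?Q u"
    proof (rule integrableI_bounded_set[of "Pi\<^sub>E (insert i I) (\<lambda>_. {0<..R})" _ _ M])
      show "Pi\<^sub>E (insert i I) (\<lambda>_. {0<..R}) \<in> sets ?Q"
        using insert(1) by (intro sets_PiM_I_finite) auto
      show "emeasure ?Q (Pi\<^sub>E (insert i I) (\<lambda>_. {0<..R})) < \<infinity>"
        using insert(1,2) \<open>0 < R\<close> by (subst emeasure_PiM) (simp_all add: power_less_top_ennreal ennreal_mult_less_top)
      show "AE x in ?Q. x \<in> Pi\<^sub>E (insert i I) (\<lambda>_. {0<..R}) \<longrightarrow> norm (u x) \<le> M"
        by (intro AE_I2) (simp add: nn b)
      show "AE x in ?Q. x \<notin> Pi\<^sub>E (insert i I) (\<lambda>_. {0<..R}) \<longrightarrow> u x = 0"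
      proof (intro AE_I2 impI)
        fix x assume "x \<in> space ?Q" "x \<notin> Pi\<^sub>E (insert i I) (\<lambda>_. {0<..R})"
        then obtain j where "j \<in> insert i I" "x j \<notin> {0<..R}"
          by (auto simp: space_PiM PiE_iff)
        then show "u x = 0" by (rule s)
      qed
    qed measurable
    then show "integral\<^sup>L ?Q u = integral\<^sup>L ?P (?sec u)"
      by (rule product_integral_insert[OF insert(1,2)])
  qed
  note prems = insert.prems
  have supp: "\<forall>x. \<forall>j\<in>insert i I. x j \<notin> {0<..R} \<longrightarrow> f x = 0" "\<forall>x. \<forall>j\<in>insert i I. x j \<notin> {0<..R} \<longrightarrow> g x = 0"
    "\<forall>x. \<forall>j\<in>insert i I. x j \<notin> {0<..R} \<longrightarrow> h x = 0"
    using prems(12-14) by blast+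
  note secf = sec[OF prems(3,6,9) supp(1)] and secg = sec[OF prems(4,7,10) supp(2)]
    and sech = sec[OF prems(5,8,11) supp(3)]
  have "integral\<^sup>L ?P (?sec f) powr (1 - t) * integral\<^sup>L ?P (?sec g) powr t \<le> integral\<^sup>L ?P (?sec h)"
  \<comment> \<open>Integrating a function bounded by \<open>M\<close> over an interval of length
    \<open>R\<close> changes the bound to \<open>M * R\<close>.\<close>
  proof (rule insert.IH[where M = "M * R"])
    fix x y assume x: "x \<in> I \<rightarrow>\<^sub>E {0<..R}" and y: "y \<in> I \<rightarrow>\<^sub>E {0<..R}"
    define z where "z = (\<lambda>j\<in>I. x j powr (1 - t) * y j powr t)"
    have sp: "x \<in> space ?P" "y \<in> space ?P" "z \<in> space ?P"
      using x y by (auto simp: space_PiM z_def)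
    show "?sec f x powr (1 - t) * ?sec g y powr t \<le> ?sec h z"
    proof (rule prekopa_leindler_real_mult[OF t, where M = M and R = R])
      fix a b assume ab: "a \<in> {0<..R}" "b \<in> {0<..R}"
      have "x(i := a) \<in> insert i I \<rightarrow>\<^sub>E {0<..R}" "y(i := b) \<in> insert i I \<rightarrow>\<^sub>E {0<..R}"
        using x y ab by (auto simp: PiE_iff extensional_def)
      from prems(15)[OF this]
      have "f (x(i := a)) powr (1 - t) * g (y(i := b)) powr t
        \<le> h (\<lambda>j\<in>insert i I. (x(i := a)) j powr (1 - t) * (y(i := b)) j powr t)" .
      also have "(\<lambda>j\<in>insert i I. (x(i := a)) j powr (1 - t) * (y(i := b)) j powr t) = z(i := a powr (1 - t) * b powr t)"
        using insert(2) by (auto simp: fun_eq_iff z_def)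
      finally show "f (x(i := a)) powr (1 - t) * g (y(i := b)) powr t \<le> h (z(i := a powr (1 - t) * b powr t))" .
    next
      fix s assume "s \<notin> {0<..R}"
      then show "f (x(i := s)) = 0" "g (y(i := s)) = 0" "h (z(i := s)) = 0"
        by (auto intro!: prems(12-14)[of i])
    next
      show "(\<lambda>s. f (x(i := s))) \<in> borel_measurable borel" by (rule secf(5)[OF sp(1)])
      show "(\<lambda>s. g (y(i := s))) \<in> borel_measurable borel" by (rule secg(5)[OF sp(2)])
      show "(\<lambda>s. h (z(i := s))) \<in> borel_measurable borel" by (rule sech(5)[OF sp(3)])
    qed (rule prems(6-11))+
  next
    show "0 < R" "0 \<le> M * R" using prems(1,2) by auto
    show "(\<lambda>x. ?sec f x) \<in> borel_measurable ?P" "(\<lambda>x. ?sec g x) \<in> borel_measurable ?P" "(\<lambda>x. ?sec h x) \<in> borel_measurable ?P"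
      by (rule secf(1) secg(1) sech(1))+
    show "0 \<le> ?sec f x" "0 \<le> ?sec g x" "0 \<le> ?sec h x" for x
      by (rule secf(2) secg(2) sech(2))+
    show "?sec f x \<le> M * R" "?sec g x \<le> M * R" "?sec h x \<le> M * R" for x
      by (rule secf(3) secg(3) sech(3))+
    show "?sec f x = 0" "?sec g x = 0" "?sec h x = 0" if "j \<in> I" "x j \<notin> {0<..R}" for x j
      using that by (rule secf(4) secg(4) sech(4))+
  qed
  then show ?case using secf(6) secg(6) sech(6) by simp
qed

section \<open>Multiplicative form for sets, and linear images\<close>

text \<open>The functional inequality for the three indicators. A common norm bound \<open>R\<close>
  confines the positive coordinates to \<open>{0<..R}\<close>, and for values in {0, 1} the
  hypothesis reduces to \<open>prod\<close>.\<close>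

lemma prekopa_leindler_sets_mult:
  fixes A B D :: "'a::euclidean_space set"
  assumes t: "0 < t" "t < 1"
    and [measurable]: "A \<in> sets borel" "B \<in> sets borel" "D \<in> sets borel"
    and bounded: "bounded A" "bounded B" "bounded D"
    and pos: "\<And>x b. x \<in> A \<union> B \<union> D \<Longrightarrow> b \<in> Basis \<Longrightarrow> 0 < x \<bullet> b"
    and prod: "\<And>x y. x \<in> A \<Longrightarrow> y \<in> B \<Longrightarrow> (\<Sum>b\<in>Basis. ((x \<bullet> b) powr (1 - t) * (y \<bullet> b) powr t) *\<^sub>R b) \<in> D"
  shows "measure lborel A powr (1 - t) * measure lborel B powr t \<le> measure lborel D"
proof -
  have "bounded (A \<union> B \<union> D)" using bounded by simp
  then obtain R where R: "0 < R" "\<And>x. x \<in> A \<union> B \<union> D \<Longrightarrow> norm x \<le> R"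
    by (meson bounded_pos)
  let ?e = "\<lambda>f. \<Sum>b\<in>Basis. f b *\<^sub>R b :: 'a"
  let ?P = "PiM (Basis :: 'a set) (\<lambda>_. lborel :: real measure)"
  have e: "?e f \<bullet> b = f b" if "b \<in> Basis" for f b
    using that by (simp add: inner_sum_left inner_Basis if_distrib sum.delta cong: if_cong)
  have [measurable]: "?e \<in> measurable ?P borel"
    by measurable
  have int: "measure lborel S = integral\<^sup>L ?P (\<lambda>f. indicator S (?e f))" if "S \<in> sets borel" for S
  proof -
    have "measure lborel S = integral\<^sup>L lborel (indicat_real S)" by simp
    also have "\<dots> = integral\<^sup>L ?P (\<lambda>f. indicator S (?e f))"
      using that by (subst lborel_eq, subst integral_distr) auto
    finally show ?thesis .
  qed
  have zero: "indicat_real S (?e x) = 0"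
    if "S \<subseteq> A \<union> B \<union> D" "i \<in> Basis" "x i \<notin> {0<..R}" for S x i
  proof -
    have "?e x \<notin> S"
    proof
      assume "?e x \<in> S"
      then have "?e x \<in> A \<union> B \<union> D" using that(1) by blast
      then have "0 < ?e x \<bullet> i" "norm (?e x) \<le> R" using pos R that(2) by blast+
      moreover have "?e x \<bullet> i \<le> norm (?e x)" using that(2) by (meson Basis_le_norm abs_le_D1)
      ultimately show False using that e by auto
    qed
    then show ?thesis by simp
  qed
  have "integral\<^sup>L ?P (\<lambda>f. indicator A (?e f)) powr (1 - t) * integral\<^sup>L ?P (\<lambda>f. indicator B (?e f)) powr t
     \<le> integral\<^sup>L ?P (\<lambda>f. indicator D (?e f))"
  proof (rule prekopa_leindler_PiM_mult[OF t, where R = R and M = 1])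
    show "indicat_real A (?e x) = 0" "indicat_real B (?e x) = 0" "indicat_real D (?e x) = 0"
      if "i \<in> Basis" "x i \<notin> {0<..R}" for x i
      using zero[of A i x] zero[of B i x] zero[of D i x] that by blast+
    show "indicat_real A (?e x) powr (1 - t) * indicat_real B (?e y) powr t
      \<le> indicat_real D (?e (\<lambda>i\<in>Basis. x i powr (1 - t) * y i powr t))" for x y
    proof (cases "?e x \<in> A \<and> ?e y \<in> B")
      case True
      from prod[of "?e x" "?e y"] True
      have "?e (\<lambda>b. x b powr (1 - t) * y b powr t) \<in> D" by (simp add: e)
      also have "?e (\<lambda>b. x b powr (1 - t) * y b powr t) = ?e (\<lambda>i\<in>Basis. x i powr (1 - t) * y i powr t)"
        by (intro sum.cong) auto
      finally show ?thesis by (auto simp: indicator_def)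
    next
      case False
      then have "indicat_real A (?e x) = 0 \<or> indicat_real B (?e y) = 0" by auto
      then show ?thesis by auto
    qed
  qed (use R(1) in auto)
  then show ?thesis by (simp add: int)
qed

section \<open>Lebesgue measure under linear bijections\<close>

lemma lborel_distr_reflect:
  fixes c :: "'a::euclidean_space"
  shows "distr lborel borel (\<lambda>x. c - x) = lborel"
  using lborel_affine[of "-1" c] by (simp add: density_1)

text \<open>The library's volume formulas for linear images assume a well-ordered index type, so
  invariance under linear maps is derived here from the uniqueness of translation-invariant
  measures, which is Fubini's theorem for \<open>(x, y) \<mapsto> indicator B y * indicator A (x + y)\<close>.\<close>

lemma translation_invariant_measure_unique:
  fixes N :: "'a::euclidean_space measure"
  assumes "sigma_finite_measure N" and sN [measurable_cong]: "sets N = sets borel"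
    and inv: "\<And>c. distr N borel ((+) c) = N"
    and [measurable]: "A \<in> sets borel" "B \<in> sets borel"
  shows "emeasure lborel A * emeasure N B = emeasure N A * emeasure lborel B"
proof -
  interpret N: sigma_finite_measure N by fact
  interpret pair_sigma_finite lborel N ..
  have "emeasure lborel A * emeasure N B = (\<integral>\<^sup>+y. (\<integral>\<^sup>+x. indicator B y * indicator A (x + y) \<partial>lborel) \<partial>N)"
  proof -
    have "(\<integral>\<^sup>+x. indicator A (x + y) \<partial>lborel) = emeasure lborel A" for y
    proof -
      have "emeasure lborel A = (\<integral>\<^sup>+x. indicator A x \<partial>distr lborel borel ((+) y))"
        unfolding lborel_distr_plus by simp
      also have "\<dots> = (\<integral>\<^sup>+x. indicator A (x + y) \<partial>lborel)"
        by (subst nn_integral_distr) (auto simp: add.commute)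
      finally show ?thesis ..
    qed
    then have "(\<integral>\<^sup>+y. (\<integral>\<^sup>+x. indicator B y * indicator A (x + y) \<partial>lborel) \<partial>N)
        = (\<integral>\<^sup>+y. indicator B y * emeasure lborel A \<partial>N)"
      by (simp add: nn_integral_cmult)
    also have "\<dots> = emeasure lborel A * emeasure N B"
      by (subst nn_integral_multc) (auto simp: mult.commute)
    finally show ?thesis ..
  qed
  also have "\<dots> = (\<integral>\<^sup>+x. (\<integral>\<^sup>+y. indicator B y * indicator A (x + y) \<partial>N) \<partial>lborel)"
    by (rule Fubini') measurable
  \<comment> \<open>Invariance of \<open>N\<close> under translation by \<open>x\<close> moves the
    shift from the argument of \<open>A\<close> to that of \<open>B\<close>, so that the integral
    over \<open>x\<close> now sees only \<open>B\<close>.\<close>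
  also have "\<dots> = (\<integral>\<^sup>+x. (\<integral>\<^sup>+y. indicator B (y - x) * indicator A y \<partial>N) \<partial>lborel)"
  proof (rule nn_integral_cong)
    fix x :: 'a
    have "(\<integral>\<^sup>+y. indicator B (y - x) * indicator A y \<partial>N) = (\<integral>\<^sup>+y. indicator B (y - x) * indicator A y \<partial>distr N borel ((+) x))"
      by (simp only: inv)
    also have "\<dots> = (\<integral>\<^sup>+y. indicator B y * indicator A (x + y) \<partial>N)"
      by (subst nn_integral_distr) auto
    finally show "(\<integral>\<^sup>+y. indicator B y * indicator A (x + y) \<partial>N) = (\<integral>\<^sup>+y. indicator B (y - x) * indicator A y \<partial>N)" ..
  qed
  also have "\<dots> = (\<integral>\<^sup>+y. (\<integral>\<^sup>+x. indicator B (y - x) * indicator A y \<partial>lborel) \<partial>N)"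
    by (rule Fubini'[symmetric]) measurable
  also have "\<dots> = emeasure N A * emeasure lborel B"
  proof -
    have "(\<integral>\<^sup>+x. indicator B (y - x) \<partial>lborel) = emeasure lborel B" for y
    proof -
      have "emeasure lborel B = (\<integral>\<^sup>+x. indicator B x \<partial>distr lborel borel (\<lambda>x. y - x))"
        unfolding lborel_distr_reflect by simp
      also have "\<dots> = (\<integral>\<^sup>+x. indicator B (y - x) \<partial>lborel)"
        by (subst nn_integral_distr) auto
      finally show ?thesis ..
    qed
    then have "(\<integral>\<^sup>+y. (\<integral>\<^sup>+x. indicator B (y - x) * indicator A y \<partial>lborel) \<partial>N)
        = (\<integral>\<^sup>+y. emeasure lborel B * indicator A y \<partial>N)"
      by (simp add: nn_integral_multc)
    also have "\<dots> = emeasure N A * emeasure lborel B"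
      by (subst nn_integral_cmult) (auto simp: mult.commute)
    finally show ?thesis .
  qed
  finally show ?thesis .
qed

lemma vimage_eq_image_inverse:
  assumes "\<And>x. g (f x) = x" "\<And>x. f (g x) = x"
  shows "f -` S = g ` S"
proof (intro set_eqI iffI)
  fix x assume "x \<in> f -` S"
  then show "x \<in> g ` S" using assms(1)[of x] by (metis imageI vimageD)
qed (use assms in auto)

text \<open>The pushforward of \<open>lborel\<close> under \<open>f\<close> is translation invariant
  and finite on balls, hence proportional to \<open>lborel\<close>. Cross-multiplication expresses
  this without dividing extended reals.\<close>

lemma emeasure_linear_vimage:
  fixes f :: "'a::euclidean_space \<Rightarrow> 'a"
  assumes f: "linear f" "inj f" and A: "A \<in> sets borel" and B: "B \<in> sets borel"
  shows "emeasure lborel A * emeasure lborel (f -` B) = emeasure lborel (f -` A) * emeasure lborel B"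
proof -
  have [measurable]: "f \<in> borel_measurable borel"
    using f by (intro borel_measurable_continuous_onI linear_continuous_on linear_conv_bounded_linear[THEN iffD1])
  obtain g where g: "linear g" "\<And>x. g (f x) = x" "\<And>x. f (g x) = x"
    using linear_injective_isomorphism[OF f] by auto
  define N where "N = distr lborel borel f"
  have em: "emeasure N S = emeasure lborel (f -` S)" if "S \<in> sets borel" for S
    unfolding N_def using that by (subst emeasure_distr) auto
  have "sigma_finite_measure N"
  proof
    have "emeasure N (ball 0 (real n)) \<noteq> \<infinity>" for n
    proof -
      have "f -` ball 0 (real n) = g ` ball 0 (real n)"
        by (rule vimage_eq_image_inverse[OF g(2,3)])
      then have "bounded (f -` ball 0 (real n))"
        using g(1) bounded_linear_image[OF bounded_ball] by (simp add: linear_conv_bounded_linear)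
      from emeasure_bounded_finite[OF this] show ?thesis by (simp add: em)
    qed
    moreover have "(\<Union>n. ball 0 (real n)) = (UNIV :: 'a set)"
      using reals_Archimedean2 by (auto simp: dist_norm)
    ultimately show "\<exists>S. countable S \<and> S \<subseteq> sets N \<and> \<Union>S = space N \<and> (\<forall>a\<in>S. emeasure N a \<noteq> \<infinity>)"
      by (intro exI[of _ "range (\<lambda>n. ball 0 (real n))"]) (auto simp: N_def)
  qed
  moreover have "distr N borel ((+) c) = N" for c
  proof -
    \<comment> \<open>Translating by \<open>c\<close> after \<open>f\<close> is translating by
      \<open>g c\<close> before it.\<close>
    have "distr N borel ((+) c) = distr lborel borel (\<lambda>x. f (g c + x))"
      unfolding N_def by (subst distr_distr) (auto simp: o_def linear_add[OF f(1)] g)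
    also have "\<dots> = distr (distr lborel borel ((+) (g c))) borel f"
      by (subst distr_distr) (auto simp: o_def)
    finally show ?thesis by (simp add: lborel_distr_plus N_def)
  qed
  ultimately have "emeasure lborel A * emeasure N B = emeasure N A * emeasure lborel B"
    using A B by (intro translation_invariant_measure_unique) (auto simp: N_def)
  then show ?thesis by (simp add: em A B)
qed

text \<open>The constant is the reciprocal of the absolute determinant, but only its existence and
  positivity matter. It is read off from the unit ball, whose preimage is open, bounded and
  nonempty.\<close>

lemma measure_linear_vimage:
  fixes f :: "'a::euclidean_space \<Rightarrow> 'a"
  assumes f: "linear f" "inj f"
  obtains c where "0 < c" "\<And>A. A \<in> sets borel \<Longrightarrow> measure lborel (f -` A) = c * measure lborel A"
proof -
  let ?B = "ball (0::'a) 1"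
  obtain g where g: "linear g" "\<And>x. g (f x) = x" "\<And>x. f (g x) = x"
    using linear_injective_isomorphism[OF f] by auto
  have cont: "continuous_on UNIV f"
    using f by (intro linear_continuous_on linear_conv_bounded_linear[THEN iffD1])
  have pos: "0 < measure lborel S" if "open S" "bounded S" "S \<noteq> {}" for S :: "'a set"
  proof -
    have "S \<notin> null_sets lborel"
      using open_not_negligible[OF that(1,3)] by (auto simp: negligible_iff_null_sets intro: null_sets_completionI)
    then have "emeasure lborel S \<noteq> 0" using that(1) by (auto simp: null_sets_def)
    then show ?thesis
      using emeasure_bounded_finite[OF that(2)] by (simp add: measure_def enn2real_positive_iff zero_less_iff_neq_zero)
  qed
  have "f -` ?B = g ` ?B" by (rule vimage_eq_image_inverse[OF g(2,3)])
  then have "bounded (f -` ?B)"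
    using g(1) bounded_linear_image[OF bounded_ball] by (simp add: linear_conv_bounded_linear)
  moreover have "open (f -` ?B)" using cont by (simp add: open_vimage)
  moreover have "0 \<in> f -` ?B" using linear_0[OF f(1)] by simp
  ultimately have p: "0 < measure lborel (f -` ?B)" using pos by blast
  have q: "0 < measure lborel ?B" by (rule pos) auto
  have "measure lborel (f -` A) = (measure lborel (f -` ?B) / measure lborel ?B) * measure lborel A"
    if "A \<in> sets borel" for A
  proof -
    have "emeasure lborel A * emeasure lborel (f -` ?B) = emeasure lborel (f -` A) * emeasure lborel ?B"
      by (rule emeasure_linear_vimage[OF f that]) simp
    then have "measure lborel A * measure lborel (f -` ?B) = measure lborel (f -` A) * measure lborel ?B"
      unfolding measure_def by (metis enn2real_mult)
    then show ?thesis using q by (simp add: eq_divide_eq mult.commute)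
  qed
  moreover have "0 < measure lborel (f -` ?B) / measure lborel ?B" using p q by simp
  ultimately show ?thesis using that by blast
qed

text \<open>The scaling constant is 1 because the unit ball is its own preimage.\<close>

lemma measure_orthogonal_vimage:
  fixes f :: "'a::euclidean_space \<Rightarrow> 'a"
  assumes f: "orthogonal_transformation f" and A: "A \<in> sets borel"
  shows "measure lborel (f -` A) = measure lborel A"
proof -
  obtain c where c: "\<And>A. A \<in> sets borel \<Longrightarrow> measure lborel (f -` A) = c * measure lborel A"
    using measure_linear_vimage[OF orthogonal_transformation_linear[OF f] orthogonal_transformation_inj[OF f]] by metis
  have "f -` ball 0 1 = ball 0 (1::real)"
    using orthogonal_transformation_norm[OF f] by auto
  then have "measure lborel (ball (0::'a) 1) = c * measure lborel (ball (0::'a) 1)"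
    using c[of "ball 0 1"] by simp
  moreover have "0 < measure lborel (ball (0::'a) 1)"
    using content_ball_pos[of 1 "0::'a"] by simp
  ultimately show ?thesis using c[OF A] by simp
qed

section \<open>Root systems and their chambers\<close>

text \<open>In the absence of a division by \<open>a \<bullet> a\<close>, this is the reflection in
  the hyperplane orthogonal to \<open>a\<close> when \<open>a\<close> is a unit vector.\<close>

definition reflection :: "'a::real_inner \<Rightarrow> 'a \<Rightarrow> 'a" where
  "reflection a x = x - (2 * (x \<bullet> a)) *\<^sub>R a"

lemma linear_reflection: "linear (reflection a)"
  by (rule linearI) (simp_all add: reflection_def algebra_simps inner_add_left)

lemma inner_reflection: "reflection a x \<bullet> y = x \<bullet> reflection a y"
  by (simp add: reflection_def algebra_simps inner_commute)

lemma reflection_involution: "norm a = 1 \<Longrightarrow> reflection a (reflection a x) = x"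
  by (simp add: reflection_def algebra_simps norm_eq_1)

lemma orthogonal_reflection:
  "norm a = 1 \<Longrightarrow> orthogonal_transformation (reflection a)"
  by (simp add: orthogonal_transformation_def linear_reflection inner_reflection reflection_involution)

lemma reflection_self: "norm a = 1 \<Longrightarrow> reflection a a = - a"
  by (simp add: reflection_def norm_eq_1 algebra_simps flip: scaleR_2)

lemma image_involution_eq:
  assumes "\<And>x. f (f x) = x" "\<And>x. x \<in> S \<Longrightarrow> f x \<in> S"
  shows "f ` S = S"
  using assms by (metis image_eqI image_subsetI subset_antisym subsetI)

text \<open>Split the vector as p - n, where n collects the negative coefficients with reversed
  sign. Obtuseness gives p \<bullet> n \<le> 0, the hypothesis gives (p - n) \<bullet> n \<ge> 0, so
  n = 0. But a nonempty positive combination of vectors on the positive side of \<open>z\<close>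
  cannot vanish.\<close>

lemma obtuse_coefficients_nonneg:
  fixes D :: "'a::real_inner set"
  assumes fin: "finite D" and pos: "\<And>d. d \<in> D \<Longrightarrow> 0 < z \<bullet> d"
    and obtuse: "\<And>d e. d \<in> D \<Longrightarrow> e \<in> D \<Longrightarrow> d \<noteq> e \<Longrightarrow> d \<bullet> e \<le> 0"
    and x: "\<And>d. d \<in> D \<Longrightarrow> 0 \<le> (\<Sum>e\<in>D. c e *\<^sub>R e) \<bullet> d" and "d \<in> D"
  shows "0 \<le> c d"
proof (rule ccontr)
  assume "\<not> 0 \<le> c d"
  define N where "N = {e\<in>D. c e < 0}"
  define n where "n = (\<Sum>e\<in>N. (- c e) *\<^sub>R e)"
  define p where "p = (\<Sum>e\<in>D - N. c e *\<^sub>R e)"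
  have N: "finite N" "N \<subseteq> D" "d \<in> N" using fin \<open>d \<in> D\<close> \<open>\<not> 0 \<le> c d\<close> by (auto simp: N_def)
  have "(\<Sum>e\<in>D. c e *\<^sub>R e) = p - n"
    unfolding p_def n_def by (subst sum.subset_diff[OF N(2) fin]) (simp add: sum_negf)
  moreover have "0 \<le> (\<Sum>e\<in>D. c e *\<^sub>R e) \<bullet> n"
    unfolding n_def inner_sum_right inner_scaleR_right using x N by (intro sum_nonneg mult_nonneg_nonneg) (auto simp: N_def)
  moreover have "p \<bullet> n = (\<Sum>f\<in>N. \<Sum>e\<in>D - N. c e * (- c f) * (e \<bullet> f))"
    unfolding p_def n_def inner_sum_left inner_sum_right by (simp add: mult.assoc mult.left_commute)
  moreover have "\<dots> \<le> 0"
    using N by (intro sum_nonpos mult_nonneg_nonpos mult_nonneg_nonneg obtuse) (auto simp: N_def)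
  ultimately have "n \<bullet> n \<le> 0" by (simp add: inner_diff_left)
  then have "n = 0" by (metis inner_eq_zero_iff inner_ge_zero order_antisym)
  have "0 < (\<Sum>e\<in>N. (- c e) * (z \<bullet> e))"
  proof (rule sum_pos)
    show "finite N" "N \<noteq> {}" using N by auto
    show "0 < - c e * (z \<bullet> e)" if "e \<in> N" for e
      using that pos[of e] N by (intro mult_pos_pos) (auto simp: N_def)
  qed
  also have "\<dots> = z \<bullet> n" by (simp add: n_def inner_sum_right)
  finally show False by (simp add: \<open>n = 0\<close>)
qed

text \<open>Roots are normalised to length 1 and no integrality is imposed, so the mirrors of
  regular polygons and of the icosahedron are covered as well.\<close>

locale root_system =
  fixes \<Phi> :: "'a::euclidean_space set"
  assumes finite_roots: "finite \<Phi>"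
    and unit_root: "\<alpha> \<in> \<Phi> \<Longrightarrow> norm \<alpha> = 1"
    and reflection_root: "\<alpha> \<in> \<Phi> \<Longrightarrow> \<beta> \<in> \<Phi> \<Longrightarrow> reflection \<alpha> \<beta> \<in> \<Phi>"
    and span_roots: "span \<Phi> = UNIV"
begin

lemma uminus_root: "\<alpha> \<in> \<Phi> \<Longrightarrow> - \<alpha> \<in> \<Phi>"
  using reflection_root[of \<alpha> \<alpha>] unit_root by (simp add: reflection_self)

lemma negligible_mirrors: "negligible (\<Union>\<alpha>\<in>\<Phi>. {w. w \<bullet> \<alpha> = 0})"
proof (rule negligible_Union)
  show "finite ((\<lambda>\<alpha>. {w. w \<bullet> \<alpha> = 0}) ` \<Phi>)" using finite_roots by simp
  fix T assume "T \<in> (\<lambda>\<alpha>. {w. w \<bullet> \<alpha> = 0}) ` \<Phi>"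
  then obtain \<alpha> where "\<alpha> \<in> \<Phi>" "T = {w. \<alpha> \<bullet> w = 0}" by (auto simp: inner_commute)
  then show "negligible T" using unit_root[of \<alpha>] by (auto intro!: negligible_hyperplane)
qed

lemma regular_exists: obtains z where "\<And>\<alpha>. \<alpha> \<in> \<Phi> \<Longrightarrow> z \<bullet> \<alpha> \<noteq> 0"
proof -
  have "(\<Union>\<alpha>\<in>\<Phi>. {w. w \<bullet> \<alpha> = 0}) \<noteq> UNIV"
    using negligible_mirrors negligible_UNIV by auto
  then show ?thesis using that by blast
qed

text \<open>Takes the place of the group generated by the reflections: all that is required of it is
  that orbits are finite and that composing with a root reflection stays inside. The family
  \<open>\<X>\<close> holds the sets whose invariance has to be carried along.\<close>

definition symmetries :: "'a set set \<Rightarrow> ('a \<Rightarrow> 'a) set" where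
  "symmetries \<X> = {g. orthogonal_transformation g \<and> g ` \<Phi> = \<Phi> \<and> (\<forall>X\<in>\<X>. g ` X = X)}"

text \<open>A linear map is determined by its values on the spanning set of roots, and there are
  finitely many maps from \<open>\<Phi>\<close> to itself.\<close>

lemma finite_orbit: "finite ((\<lambda>g. g u) ` symmetries \<X>)"
proof -
  let ?r = "\<lambda>g. restrict g \<Phi>"
  have "?r ` symmetries \<X> \<subseteq> \<Phi> \<rightarrow>\<^sub>E \<Phi>"
    by (auto simp: symmetries_def)
  moreover have "finite (\<Phi> \<rightarrow>\<^sub>E \<Phi>)" using finite_roots by (simp add: finite_PiE)
  ultimately have "finite (?r ` symmetries \<X>)" by (rule finite_subset)
  moreover have "inj_on ?r (symmetries \<X>)"
  proof (rule inj_onI)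
    fix g h assume gh: "g \<in> symmetries \<X>" "h \<in> symmetries \<X>" and eq: "restrict g \<Phi> = restrict h \<Phi>"
    have "g x = h x" for x
    proof (rule linear_eq_on_span[of g h \<Phi>])
      show "g \<beta> = h \<beta>" if "\<beta> \<in> \<Phi>" for \<beta> using fun_cong[OF eq, of \<beta>] that by simp
    qed (use gh span_roots in \<open>auto simp: symmetries_def orthogonal_transformation_linear\<close>)
    then show "g = h" by (rule ext)
  qed
  ultimately have "finite (symmetries \<X>)" by (rule finite_imageD)
  then show ?thesis by (rule finite_imageI)
qed

lemma id_symmetry: "id \<in> symmetries \<X>"
  by (simp add: symmetries_def orthogonal_transformation_id[unfolded id_def[symmetric]])

lemma reflection_comp_symmetry:
  assumes "\<alpha> \<in> \<Phi>" "g \<in> symmetries \<X>" "\<And>X. X \<in> \<X> \<Longrightarrow> reflection \<alpha> ` X = X"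
  shows "reflection \<alpha> \<circ> g \<in> symmetries \<X>"
proof -
  have "reflection \<alpha> ` \<Phi> = \<Phi>"
    using assms(1) by (intro image_involution_eq) (auto simp: reflection_involution unit_root reflection_root)
  then have "(reflection \<alpha> \<circ> g) ` \<Phi> = \<Phi>" "\<forall>X\<in>\<X>. (reflection \<alpha> \<circ> g) ` X = X"
    unfolding image_comp[symmetric] using assms by (simp_all add: symmetries_def)
  moreover have "orthogonal_transformation (reflection \<alpha> \<circ> g)"
    using assms by (intro orthogonal_transformation_compose orthogonal_reflection unit_root) (simp_all add: symmetries_def)
  ultimately show ?thesis by (simp add: symmetries_def)
qed

end

section \<open>Positive roots, the chamber and its simple roots\<close>

locale root_chamber = root_system +
  fixes z :: 'a
  assumes regular: "\<alpha> \<in> \<Phi> \<Longrightarrow> z \<bullet> \<alpha> \<noteq> 0"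
begin

definition positive_roots :: "'a set" where
  "positive_roots = {\<alpha>\<in>\<Phi>. 0 < z \<bullet> \<alpha>}"

definition chamber :: "'a set" where
  "chamber = {w. \<forall>\<alpha>\<in>positive_roots. 0 < w \<bullet> \<alpha>}"

lemma positive_roots_subset: "positive_roots \<subseteq> \<Phi>"
  by (auto simp: positive_roots_def)

lemma positive_or_negative: "\<alpha> \<in> \<Phi> \<Longrightarrow> \<alpha> \<in> positive_roots \<or> - \<alpha> \<in> positive_roots"
  using regular[of \<alpha>] uminus_root[of \<alpha>] by (auto simp: positive_roots_def)

lemma chamber_open: "open chamber"
proof -
  have "chamber = (\<Inter>\<alpha>\<in>positive_roots. {w. \<alpha> \<bullet> w > 0})"
    by (auto simp: chamber_def inner_commute)
  moreover have "finite positive_roots" using finite_subset[OF positive_roots_subset finite_roots] .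
  ultimately show ?thesis by (auto intro!: open_INT open_halfspace_gt)
qed

text \<open>Choose \<open>g\<close> to maximise p \<bullet> g u over the finite orbit. If g u had
  negative product with a positive root, reflecting in that root would increase the value further,
  since p pairs positively with it.\<close>

lemma move_to_chamber:
  assumes inv: "\<And>\<alpha> X. \<alpha> \<in> \<Phi> \<Longrightarrow> X \<in> \<X> \<Longrightarrow> reflection \<alpha> ` X = X" and p: "p \<in> chamber"
  shows "\<exists>g\<in>symmetries \<X>. p \<bullet> u \<le> p \<bullet> g u \<and> (\<forall>\<alpha>\<in>positive_roots. 0 \<le> g u \<bullet> \<alpha>)"
proof -
  let ?V = "(\<lambda>g. p \<bullet> g u) ` symmetries \<X>"
  have "finite ?V" using finite_imageI[OF finite_orbit[of u \<X>], of "\<lambda>v. p \<bullet> v"] by (simp add: image_image)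
  moreover have "?V \<noteq> {}" using id_symmetry by blast
  ultimately have "Max ?V \<in> ?V" by (rule Max_in)
  then obtain g where g: "g \<in> symmetries \<X>" "Max ?V = p \<bullet> g u" by blast
  have max: "p \<bullet> h u \<le> p \<bullet> g u" if "h \<in> symmetries \<X>" for h
    unfolding g(2)[symmetric] using \<open>finite ?V\<close> that by (intro Max_ge) auto
  have "0 \<le> g u \<bullet> \<alpha>" if "\<alpha> \<in> positive_roots" for \<alpha>
  proof -
    have \<alpha>: "\<alpha> \<in> \<Phi>" using that positive_roots_subset by blast
    have "p \<bullet> reflection \<alpha> (g u) \<le> p \<bullet> g u"
      using max[OF reflection_comp_symmetry[OF \<alpha> g(1) inv[OF \<alpha>]]] by simp
    then have "0 \<le> (g u \<bullet> \<alpha>) * (p \<bullet> \<alpha>)" by (simp add: reflection_def inner_diff_right mult.commute)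
    moreover have "0 < p \<bullet> \<alpha>" using p that by (auto simp: chamber_def)
    ultimately show ?thesis by (auto simp: zero_le_mult_iff)
  qed
  then show ?thesis using g(1) max[OF id_symmetry] by auto
qed

lemma regular_in_chamber: "z \<in> chamber"
  by (auto simp: chamber_def positive_roots_def)

definition generates :: "'a set \<Rightarrow> bool" where
  "generates D \<longleftrightarrow> (\<forall>\<alpha>\<in>positive_roots. \<exists>c. (\<forall>\<gamma>\<in>D. 0 \<le> c \<gamma>) \<and> \<alpha> = (\<Sum>\<gamma>\<in>D. c \<gamma> *\<^sub>R \<gamma>))"

text \<open>The equation can be solved for \<open>\<gamma>\<close> in terms of the other generators,
  which makes \<open>\<gamma>\<close> redundant and contradicts minimality.\<close>

lemma minimal_generates:
  assumes D: "D \<subseteq> positive_roots" "generates D" and min: "\<And>\<gamma>. \<gamma> \<in> D \<Longrightarrow> \<not> generates (D - {\<gamma>})"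
    and \<gamma>: "\<gamma> \<in> D" and eq: "r *\<^sub>R \<gamma> = (\<Sum>\<delta>\<in>D. c \<delta> *\<^sub>R \<delta>)" and c: "\<And>\<delta>. \<delta> \<in> D \<Longrightarrow> 0 \<le> c \<delta>"
    and \<epsilon>: "\<epsilon> \<in> D" "\<epsilon> \<noteq> \<gamma>" "0 < c \<epsilon>"
  shows False
proof -
  have fin: "finite D" using D(1) positive_roots_subset finite_roots by (meson finite_subset)
  have z: "0 < z \<bullet> \<delta>" if "\<delta> \<in> D" for \<delta> using that D(1) by (auto simp: positive_roots_def)
  have eq': "(r - c \<gamma>) *\<^sub>R \<gamma> = (\<Sum>\<delta>\<in>D - {\<gamma>}. c \<delta> *\<^sub>R \<delta>)"
    using eq \<gamma> fin by (simp add: sum.remove[of D \<gamma>] algebra_simps)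
  \<comment> \<open>Pairing with \<open>z\<close> shows that the coefficient left on
    \<open>\<gamma>\<close> is positive; the term of \<open>\<epsilon>\<close> makes the inequality
    strict.\<close>
  have "0 < (\<Sum>\<delta>\<in>D - {\<gamma>}. c \<delta> * (z \<bullet> \<delta>))"
    using fin \<epsilon> c z by (intro sum_pos2[of _ \<epsilon>]) (auto simp: less_imp_le)
  also have "\<dots> = z \<bullet> ((r - c \<gamma>) *\<^sub>R \<gamma>)" unfolding eq' by (simp add: inner_sum_right)
  finally have r: "0 < r - c \<gamma>" using z[OF \<gamma>] by (simp add: zero_less_mult_iff)
  define e where "e \<delta> = c \<delta> / (r - c \<gamma>)" for \<delta>
  have \<gamma>_eq: "\<gamma> = (\<Sum>\<delta>\<in>D - {\<gamma>}. e \<delta> *\<^sub>R \<delta>)"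
  proof -
    have "\<gamma> = (1 / (r - c \<gamma>)) *\<^sub>R ((r - c \<gamma>) *\<^sub>R \<gamma>)" using r by simp
    also have "\<dots> = (\<Sum>\<delta>\<in>D - {\<gamma>}. e \<delta> *\<^sub>R \<delta>)"
      unfolding eq' by (simp add: scaleR_right.sum e_def)
    finally show ?thesis .
  qed
  have "generates (D - {\<gamma>})"
    unfolding generates_def
  proof
    fix \<alpha> assume "\<alpha> \<in> positive_roots"
    then obtain a where a: "\<forall>\<delta>\<in>D. 0 \<le> a \<delta>" "\<alpha> = (\<Sum>\<delta>\<in>D. a \<delta> *\<^sub>R \<delta>)"
      using D(2) by (auto simp: generates_def)
    have "\<alpha> = a \<gamma> *\<^sub>R (\<Sum>\<delta>\<in>D - {\<gamma>}. e \<delta> *\<^sub>R \<delta>) + (\<Sum>\<delta>\<in>D - {\<gamma>}. a \<delta> *\<^sub>R \<delta>)"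
      using a(2) \<gamma> fin \<gamma>_eq by (simp add: sum.remove[of D \<gamma>])
    also have "\<dots> = (\<Sum>\<delta>\<in>D - {\<gamma>}. (a \<gamma> * e \<delta> + a \<delta>) *\<^sub>R \<delta>)"
      by (simp add: scaleR_right.sum sum.distrib algebra_simps)
    finally show "\<exists>c. (\<forall>\<delta>\<in>D - {\<gamma>}. 0 \<le> c \<delta>) \<and> \<alpha> = (\<Sum>\<delta>\<in>D - {\<gamma>}. c \<delta> *\<^sub>R \<delta>)"
      using a(1) c r \<gamma> by (intro exI[of _ "\<lambda>\<delta>. a \<gamma> * e \<delta> + a \<delta>"]) (auto simp: e_def)
  qed
  then show False using min \<gamma> by blast
qed

text \<open>Take a generating set of least cardinality. If \<alpha> \<bullet> \<beta> > 0 for two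
  members, then \<sigma> = \<beta> - k \<alpha> with k > 0 is a root. If \<sigma> is positive,
  \<beta> = \<sigma> + k \<alpha> makes \<beta> redundant; if -\<sigma> is positive, k \<alpha> =
  -\<sigma> + \<beta> makes \<alpha> redundant.\<close>

lemma simple_roots_exist:
  obtains D where "D \<subseteq> positive_roots" "generates D"
    "\<And>\<alpha> \<beta>. \<alpha> \<in> D \<Longrightarrow> \<beta> \<in> D \<Longrightarrow> \<alpha> \<noteq> \<beta> \<Longrightarrow> \<alpha> \<bullet> \<beta> \<le> 0"
proof -
  have finp: "finite positive_roots" using finite_subset[OF positive_roots_subset finite_roots] .
  have "\<alpha> = (\<Sum>\<gamma>\<in>positive_roots. (if \<gamma> = \<alpha> then 1 else 0) *\<^sub>R \<gamma>)" if "\<alpha> \<in> positive_roots" for \<alpha>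
    using that finp by (simp add: if_distrib[of "\<lambda>c. c *\<^sub>R _"] cong: if_cong)
  then have "generates positive_roots"
    unfolding generates_def by (intro ballI exI[of _ "\<lambda>\<gamma>. if \<gamma> = _ then 1 else 0"]) auto
  from ex_has_least_nat[of "\<lambda>D. D \<subseteq> positive_roots \<and> generates D" _ card, OF conjI[OF order_refl \<open>generates positive_roots\<close>]]
  obtain D where D: "D \<subseteq> positive_roots" "generates D"
    and least: "\<And>E. E \<subseteq> positive_roots \<Longrightarrow> generates E \<Longrightarrow> card D \<le> card E" by blast
  have fin: "finite D" using D(1) finp finite_subset by blast
  have min: "\<not> generates (D - {\<gamma>})" if "\<gamma> \<in> D" for \<gamma>
    using least[of "D - {\<gamma>}"] D(1) that fin card_Diff1_less[OF fin that] by auto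
  have "\<alpha> \<bullet> \<beta> \<le> 0" if ab: "\<alpha> \<in> D" "\<beta> \<in> D" "\<alpha> \<noteq> \<beta>" for \<alpha> \<beta>
  proof (rule ccontr)
    assume "\<not> \<alpha> \<bullet> \<beta> \<le> 0"
    define k where "k = 2 * (\<beta> \<bullet> \<alpha>)"
    have k: "0 < k" using \<open>\<not> \<alpha> \<bullet> \<beta> \<le> 0\<close> by (simp add: k_def inner_commute)
    define \<sigma> where "\<sigma> = reflection \<alpha> \<beta>"
    have \<sigma>: "\<sigma> = \<beta> - k *\<^sub>R \<alpha>" by (simp add: \<sigma>_def reflection_def k_def)
    have "\<sigma> \<in> \<Phi>" unfolding \<sigma>_def using ab D(1) positive_roots_subset by (intro reflection_root) auto
    have ind: "(\<Sum>\<delta>\<in>D. (c \<delta> + (if \<delta> = \<epsilon> then s else 0)) *\<^sub>R \<delta>) = (\<Sum>\<delta>\<in>D. c \<delta> *\<^sub>R \<delta>) + s *\<^sub>R \<epsilon>"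
      if "\<epsilon> \<in> D" for c s \<epsilon>
      using that fin by (simp add: scaleR_add_left sum.distrib if_distrib[of "\<lambda>c. c *\<^sub>R _"] cong: if_cong)
    from positive_or_negative[OF \<open>\<sigma> \<in> \<Phi>\<close>] show False
    proof
      assume "\<sigma> \<in> positive_roots"
      then obtain c where c: "\<forall>\<gamma>\<in>D. 0 \<le> c \<gamma>" "\<sigma> = (\<Sum>\<gamma>\<in>D. c \<gamma> *\<^sub>R \<gamma>)" using D(2) by (auto simp: generates_def)
      have "1 *\<^sub>R \<beta> = (\<Sum>\<delta>\<in>D. (c \<delta> + (if \<delta> = \<alpha> then k else 0)) *\<^sub>R \<delta>)"
        unfolding ind[OF ab(1)] c(2)[symmetric] by (simp add: \<sigma>)
      then show False
        using minimal_generates[OF D min ab(2), of 1 "\<lambda>\<delta>. c \<delta> + (if \<delta> = \<alpha> then k else 0)" \<alpha>] ab c(1) k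
        by (auto simp: add_nonneg_pos)
    next
      assume "- \<sigma> \<in> positive_roots"
      then obtain c where c: "\<forall>\<gamma>\<in>D. 0 \<le> c \<gamma>" "- \<sigma> = (\<Sum>\<gamma>\<in>D. c \<gamma> *\<^sub>R \<gamma>)" using D(2) by (auto simp: generates_def)
      have "k *\<^sub>R \<alpha> = (\<Sum>\<delta>\<in>D. (c \<delta> + (if \<delta> = \<beta> then 1 else 0)) *\<^sub>R \<delta>)"
        unfolding ind[OF ab(2)] c(2)[symmetric] by (simp add: \<sigma>)
      then show False
        using minimal_generates[OF D min ab(1), of k "\<lambda>\<delta>. c \<delta> + (if \<delta> = \<beta> then 1 else 0)" \<beta>] ab c(1) k
        by (auto simp: add_nonneg_pos)
    qed
  qed
  then show ?thesis using that[OF D] by blast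
qed

text \<open>The coordinates of \<open>T w\<close> are the inner products of w with the simple roots.
  The last clause says that the closed chamber lies in the cone spanned by the simple roots, so that
  its directions act on these coordinates with nonnegative weights.\<close>

lemma chamber_coordinates:
  obtains T :: "'a \<Rightarrow> 'a" where "linear T" "inj T"
    "\<And>w. w \<in> chamber \<longleftrightarrow> (\<forall>b\<in>Basis. 0 < T w \<bullet> b)"
    "\<And>u. (\<And>\<alpha>. \<alpha> \<in> positive_roots \<Longrightarrow> 0 \<le> u \<bullet> \<alpha>) \<Longrightarrow>
       \<exists>c. (\<forall>b\<in>Basis. 0 \<le> c b) \<and> (\<forall>x. x \<bullet> u = (\<Sum>b\<in>Basis. c b * (T x \<bullet> b)))"
proof -
  obtain D where D: "D \<subseteq> positive_roots" "generates D"
    and obtuse: "\<And>\<alpha> \<beta>. \<alpha> \<in> D \<Longrightarrow> \<beta> \<in> D \<Longrightarrow> \<alpha> \<noteq> \<beta> \<Longrightarrow> \<alpha> \<bullet> \<beta> \<le> 0"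
    using simple_roots_exist by blast
  have fin: "finite D" using D(1) positive_roots_subset finite_roots by (meson finite_subset)
  have z: "0 < z \<bullet> \<delta>" if "\<delta> \<in> D" for \<delta> using that D(1) by (auto simp: positive_roots_def)
  have nonneg: "0 \<le> c \<delta>" if "\<And>\<delta>. \<delta> \<in> D \<Longrightarrow> 0 \<le> (\<Sum>\<gamma>\<in>D. c \<gamma> *\<^sub>R \<gamma>) \<bullet> \<delta>" "\<delta> \<in> D" for c \<delta>
    using obtuse_coefficients_nonneg[OF fin, of z c \<delta>] z obtuse that by blast
  \<comment> \<open>For a linear relation both the coefficients and their negatives represent the
    vector 0, so obtuseness makes both nonnegative.\<close>
  have "independent D"
  proof
    assume "dependent D"
    then obtain c \<delta> where c: "\<delta> \<in> D" "c \<delta> \<noteq> 0" "(\<Sum>\<epsilon>\<in>D. c \<epsilon> *\<^sub>R \<epsilon>) = 0"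
      using fin by (auto simp: dependent_finite)
    have "0 \<le> c \<delta>" by (rule nonneg) (use c in auto)
    moreover have "0 \<le> - c \<delta>"
      by (rule nonneg[where c = "\<lambda>\<epsilon>. - c \<epsilon>"]) (use c in \<open>auto simp: sum_negf\<close>)
    ultimately show False using c(2) by simp
  qed
  have spanD: "span D = UNIV"
  proof -
    have pos: "\<alpha> \<in> span D" if "\<alpha> \<in> positive_roots" for \<alpha>
    proof -
      obtain c where "\<alpha> = (\<Sum>\<gamma>\<in>D. c \<gamma> *\<^sub>R \<gamma>)" using D(2) \<open>\<alpha> \<in> positive_roots\<close> unfolding generates_def by blast
      moreover have "(\<Sum>\<gamma>\<in>D. c \<gamma> *\<^sub>R \<gamma>) \<in> span D" by (intro span_sum span_scale span_base)
      ultimately show ?thesis by simp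
    qed
    have "\<Phi> \<subseteq> span D"
    proof
      fix \<alpha> assume "\<alpha> \<in> \<Phi>"
      from positive_or_negative[OF this] show "\<alpha> \<in> span D"
        using pos[of \<alpha>] pos[of "- \<alpha>"] span_neg[of "- \<alpha>" D] by auto
    qed
    then show ?thesis using span_roots span_minimal[of \<Phi> "span D"] by auto
  qed
  have "card D = card (Basis :: 'a set)"
    using basis_card_eq_dim[of D UNIV] \<open>independent D\<close> spanD by simp
  \<comment> \<open>The simple roots form a basis, so the standard basis vectors can label
    them.\<close>
  then obtain \<phi> where \<phi>: "bij_betw \<phi> (Basis :: 'a set) D"
    using fin finite_same_card_bij[of "Basis :: 'a set" D] by auto
  define T where "T x = (\<Sum>b\<in>Basis. (x \<bullet> \<phi> b) *\<^sub>R b)" for x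
  have Tb: "T x \<bullet> b = x \<bullet> \<phi> b" if "b \<in> Basis" for x b
    using that by (simp add: T_def inner_sum_left inner_Basis if_distrib sum.delta cong: if_cong)
  show ?thesis
  proof
    show lin: "linear T"
      by (rule linearI) (simp_all add: T_def inner_add_left algebra_simps sum.distrib scaleR_right.sum)
    show "inj T"
    proof (rule linear_injective_0[OF lin, THEN iffD2], intro allI impI)
      fix x assume "T x = 0"
      then have "x \<bullet> \<delta> = 0" if "\<delta> \<in> D" for \<delta>
        using that Tb[of _ x] \<phi> by (metis bij_betw_imp_surj_on imageE inner_zero_left)
      then have "orthogonal x v" if "v \<in> D" for v using that by (simp add: orthogonal_def)
      then have "orthogonal x x" using orthogonal_to_span[of x D x] spanD by auto
      then show "x = 0" by (simp add: orthogonal_def)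
    qed
    show "w \<in> chamber \<longleftrightarrow> (\<forall>b\<in>Basis. 0 < T w \<bullet> b)" for w
    proof -
      have "(\<forall>b\<in>Basis. 0 < T w \<bullet> b) \<longleftrightarrow> (\<forall>\<delta>\<in>\<phi> ` Basis. 0 < w \<bullet> \<delta>)" by (simp add: Tb)
      also have "\<dots> \<longleftrightarrow> (\<forall>\<delta>\<in>D. 0 < w \<bullet> \<delta>)" using \<phi> by (simp add: bij_betw_def)
      also have "\<dots> \<longleftrightarrow> w \<in> chamber"
      proof
        assume w: "\<forall>\<delta>\<in>D. 0 < w \<bullet> \<delta>"
        have "0 < w \<bullet> \<alpha>" if \<alpha>: "\<alpha> \<in> positive_roots" for \<alpha>
        proof -
          obtain c where c: "\<forall>\<gamma>\<in>D. 0 \<le> c \<gamma>" "\<alpha> = (\<Sum>\<gamma>\<in>D. c \<gamma> *\<^sub>R \<gamma>)" using D(2) \<alpha> unfolding generates_def by blast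
          have "\<alpha> \<noteq> 0" using \<alpha> by (auto simp: positive_roots_def)
          then obtain \<epsilon> where "\<epsilon> \<in> D" "c \<epsilon> \<noteq> 0" using c(2) sum.neutral[of D "\<lambda>\<gamma>. c \<gamma> *\<^sub>R \<gamma>"] by fastforce
          then have "0 < (\<Sum>\<gamma>\<in>D. c \<gamma> * (w \<bullet> \<gamma>))"
            using c(1) w fin by (intro sum_pos2[of _ \<epsilon>] mult_pos_pos mult_nonneg_nonneg) (auto simp: less_le)
          then show ?thesis unfolding c(2) by (simp add: inner_sum_right)
        qed
        then show "w \<in> chamber" by (simp add: chamber_def)
      qed (use D(1) in \<open>auto simp: chamber_def\<close>)
      finally show ?thesis ..
    qed
    show "\<exists>c. (\<forall>b\<in>Basis. 0 \<le> c b) \<and> (\<forall>x. x \<bullet> u = (\<Sum>b\<in>Basis. c b * (T x \<bullet> b)))"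
      if u: "\<And>\<alpha>. \<alpha> \<in> positive_roots \<Longrightarrow> 0 \<le> u \<bullet> \<alpha>" for u
    proof -
      have "u \<in> span D" using spanD by simp
      then obtain c where c: "u = (\<Sum>\<delta>\<in>D. c \<delta> *\<^sub>R \<delta>)" unfolding span_finite[OF fin] by auto
      have "0 \<le> c \<delta>" if "\<delta> \<in> D" for \<delta>
        by (rule nonneg) (use u D(1) c that in auto)
      moreover have "x \<bullet> u = (\<Sum>b\<in>Basis. c (\<phi> b) * (T x \<bullet> b))" for x
      proof -
        have "(\<Sum>b\<in>Basis. c (\<phi> b) * (T x \<bullet> b)) = (\<Sum>b\<in>Basis. c (\<phi> b) * (x \<bullet> \<phi> b))" by (simp add: Tb)
        also have "\<dots> = (\<Sum>\<delta>\<in>D. c \<delta> * (x \<bullet> \<delta>))" by (rule sum.reindex_bij_betw[OF \<phi>])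
        finally show ?thesis unfolding c by (simp add: inner_sum_right)
      qed
      ultimately show ?thesis
        using \<phi> by (intro exI[of _ "c \<circ> \<phi>"]) (auto simp: bij_betw_def)
    qed
  qed
qed

end

section \<open>Volumes of reflection-invariant sets\<close>

text \<open>Homogeneity of the geometric mean. It absorbs the number of chambers, the constant of a
  linear change of variables and the weights of a direction.\<close>

lemma weighted_mean_mult:
  fixes a b m t :: real
  assumes "0 \<le> m"
  shows "(m * a) powr (1 - t) * (m * b) powr t = m * (a powr (1 - t) * b powr t)"
proof -
  have "(m * a) powr (1 - t) * (m * b) powr t = (m powr (1 - t) * m powr t) * (a powr (1 - t) * b powr t)"
    by (simp only: powr_mult mult.assoc mult.left_commute)
  also have "m powr (1 - t) * m powr t = m" using assms by (simp flip: powr_add)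
  finally show ?thesis .
qed

context root_chamber
begin

text \<open>That \<open>N\<close> does not depend on \<open>X\<close> is the point, since it is
  later cancelled among three sets. It counts the sign patterns of the roots at points off the
  mirrors; each cell is carried onto the chamber by an orthogonal map preserving \<open>X\<close>,
  and the mirrors are null.\<close>

lemma measure_eq_chambers:
  obtains N :: nat where "0 < N"
    "\<And>X. X \<in> sets borel \<Longrightarrow> bounded X \<Longrightarrow> (\<And>\<alpha>. \<alpha> \<in> \<Phi> \<Longrightarrow> reflection \<alpha> ` X = X) \<Longrightarrow>
       measure lborel X = N * measure lborel (X \<inter> chamber)"
proof -
  define Reg where "Reg = {w. \<forall>\<alpha>\<in>\<Phi>. w \<bullet> \<alpha> \<noteq> 0}"
  define S where "S w = {\<alpha>\<in>\<Phi>. 0 < w \<bullet> \<alpha>}" for w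
  define C where "C s = {w\<in>Reg. S w = s}" for s
  have fin: "finite (S ` Reg)"
    by (rule finite_subset[of _ "Pow \<Phi>"]) (auto simp: S_def finite_roots)
  have openC: "open (C s)" for s
  proof (cases "s \<subseteq> \<Phi>")
    case True
    have "w \<in> C s \<longleftrightarrow> (\<forall>\<alpha>\<in>\<Phi>. w \<in> (if \<alpha> \<in> s then {w. \<alpha> \<bullet> w > 0} else {w. \<alpha> \<bullet> w < 0}))" for w
    proof
      assume w: "w \<in> C s"
      then have "s = {\<alpha>\<in>\<Phi>. 0 < \<alpha> \<bullet> w}" "\<forall>\<alpha>\<in>\<Phi>. \<alpha> \<bullet> w \<noteq> 0"
        by (auto simp: C_def S_def Reg_def inner_commute)
      then show "\<forall>\<alpha>\<in>\<Phi>. w \<in> (if \<alpha> \<in> s then {w. \<alpha> \<bullet> w > 0} else {w. \<alpha> \<bullet> w < 0})" by auto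
    next
      assume w: "\<forall>\<alpha>\<in>\<Phi>. w \<in> (if \<alpha> \<in> s then {w. \<alpha> \<bullet> w > 0} else {w. \<alpha> \<bullet> w < 0})"
      then have *: "(\<alpha> \<in> s \<and> 0 < w \<bullet> \<alpha>) \<or> (\<alpha> \<notin> s \<and> w \<bullet> \<alpha> < 0)" if "\<alpha> \<in> \<Phi>" for \<alpha>
        using that by (auto simp: inner_commute split: if_splits)
      have "w \<in> Reg" unfolding Reg_def using * by force
      moreover have "S w = s" unfolding S_def using * True by force
      ultimately show "w \<in> C s" by (simp add: C_def)
    qed
    then have "C s = (\<Inter>\<alpha>\<in>\<Phi>. if \<alpha> \<in> s then {w. \<alpha> \<bullet> w > 0} else {w. \<alpha> \<bullet> w < 0})" by blast
    then show ?thesis using finite_roots by (auto intro!: open_INT simp: open_halfspace_gt open_halfspace_lt)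
  next
    case False
    then have "C s = {}" by (auto simp: C_def S_def)
    then show ?thesis by simp
  qed
  show ?thesis
  proof
    show "0 < card (S ` Reg)"
    proof -
      have "z \<in> Reg" using regular by (simp add: Reg_def)
      then show ?thesis using fin by (auto simp: card_gt_0_iff)
    qed
    fix X assume X: "X \<in> sets borel" "bounded X" and inv: "\<And>\<alpha>. \<alpha> \<in> \<Phi> \<Longrightarrow> reflection \<alpha> ` X = X"
    have borel: "X \<inter> C s \<in> sets borel" for s
      by (rule sets.Int[OF X(1) borel_open[OF openC]])
    have "measure lborel (X \<inter> C s) = measure lborel (X \<inter> chamber)" if s: "s \<in> S ` Reg" for s
    proof -
      obtain w0 where w0: "w0 \<in> Reg" "s = S w0" using s by blast
      have inv': "reflection \<alpha> ` Y = Y" if "\<alpha> \<in> \<Phi>" "Y \<in> {X}" for \<alpha> Y using inv that by simp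
      \<comment> \<open>One point \<open>w0\<close> of the cell is moved into the closed chamber.
        Being off all mirrors it lands in the open one, and as \<open>g\<close> permutes the roots
        the whole cell, which shares its signs, follows.\<close>
      obtain g where g: "g \<in> symmetries {X}" and g0: "\<And>\<alpha>. \<alpha> \<in> positive_roots \<Longrightarrow> 0 \<le> g w0 \<bullet> \<alpha>"
        using move_to_chamber[OF inv' regular_in_chamber, of "{X}" w0] by blast
      have orth: "orthogonal_transformation g" and gX: "g ` X = X" and g\<Phi>: "g ` \<Phi> = \<Phi>"
        using g(1) by (auto simp: symmetries_def)
      have inner: "g v \<bullet> g w = v \<bullet> w" for v w using orth by (simp add: orthogonal_transformation_def)
      have g0': "0 < w0 \<bullet> \<beta>" if "\<beta> \<in> \<Phi>" "g \<beta> \<in> positive_roots" for \<beta>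
        using g0[OF that(2)] that(1) w0(1) by (auto simp: inner Reg_def less_le)
      have mem: "g w \<in> chamber \<longleftrightarrow> w \<in> C s" for w
      proof
        assume w: "w \<in> C s"
        have "0 < g w \<bullet> \<alpha>" if \<alpha>: "\<alpha> \<in> positive_roots" for \<alpha>
        proof -
          obtain \<beta> where \<beta>: "\<beta> \<in> \<Phi>" "\<alpha> = g \<beta>" using \<alpha> positive_roots_subset g\<Phi> by blast
          then have "\<beta> \<in> S w" using g0'[of \<beta>] \<alpha> w by (auto simp: C_def S_def w0(2))
          then show ?thesis by (simp add: \<beta> inner S_def)
        qed
        then show "g w \<in> chamber" by (simp add: chamber_def)
      next
        assume w: "g w \<in> chamber"
        have pos: "0 < w \<bullet> \<beta>" if "\<beta> \<in> \<Phi>" "g \<beta> \<in> positive_roots" for \<beta>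
          using w that(2) inner[of w \<beta>] by (auto simp: chamber_def)
        have *: "(0 < w \<bullet> \<beta> \<and> 0 < w0 \<bullet> \<beta>) \<or> (w \<bullet> \<beta> < 0 \<and> w0 \<bullet> \<beta> < 0)" if \<beta>: "\<beta> \<in> \<Phi>" for \<beta>
        proof -
          have "g \<beta> \<in> \<Phi>" using \<beta> g\<Phi> by blast
          from positive_or_negative[OF this] show ?thesis
          proof
            assume "g \<beta> \<in> positive_roots"
            then show ?thesis using pos g0' \<beta> by blast
          next
            assume "- g \<beta> \<in> positive_roots"
            then have "g (- \<beta>) \<in> positive_roots"
              using linear_neg[OF orthogonal_transformation_linear[OF orth]] by simp
            then show ?thesis using pos[of "- \<beta>"] g0'[of "- \<beta>"] uminus_root[OF \<beta>] by simp
          qed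
        qed
        have "w \<in> Reg" unfolding Reg_def using * by force
        moreover have "S w = S w0" unfolding S_def using * by force
        ultimately show "w \<in> C s" by (simp add: C_def w0(2))
      qed
      have "g w \<in> X \<longleftrightarrow> w \<in> X" for w
        using inj_image_mem_iff[OF orthogonal_transformation_inj[OF orth], of w X] gX by simp
      then have "X \<inter> C s = g -` (X \<inter> chamber)" using mem by blast
      then show ?thesis
        using measure_orthogonal_vimage[OF orth, of "X \<inter> chamber"] X(1) chamber_open by simp
    qed
    then have "(\<Sum>s\<in>S ` Reg. measure lborel (X \<inter> C s)) = card (S ` Reg) * measure lborel (X \<inter> chamber)"
      by simp
    moreover have "(\<Sum>s\<in>S ` Reg. measure lborel (X \<inter> C s)) = measure lborel (\<Union>s\<in>S ` Reg. X \<inter> C s)"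
    proof (rule measure_finite_Union[symmetric])
      show "disjoint_family_on (\<lambda>s. X \<inter> C s) (S ` Reg)"
        by (auto simp: disjoint_family_on_def C_def)
      show "emeasure lborel (X \<inter> C s) \<noteq> \<infinity>" for s
        using emeasure_bounded_finite[OF bounded_subset[OF X(2) Int_lower1[of X "C s"]]] by simp
      show "(\<lambda>s. X \<inter> C s) ` (S ` Reg) \<subseteq> sets lborel" using borel by auto
    qed (rule fin)
    moreover have "measure lborel (\<Union>s\<in>S ` Reg. X \<inter> C s) = measure lborel X"
    proof -
      let ?M = "\<Union>\<alpha>\<in>\<Phi>. {w. \<alpha> \<bullet> w = 0}"
      have "?M = (\<Union>\<alpha>\<in>\<Phi>. {w. w \<bullet> \<alpha> = 0})" by (simp add: inner_commute)
      then have "?M \<in> null_sets lebesgue" using negligible_mirrors by (simp add: negligible_iff_null_sets)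
      \<comment> \<open>Negligibility concerns the completed measure; closedness brings the null set
        back to \<open>lborel\<close>.\<close>
      moreover have "closed ?M" using finite_roots by (auto intro!: closed_UN closed_hyperplane)
      ultimately have "?M \<in> null_sets lborel" by (auto simp: null_sets_def)
      moreover have "(\<Union>s\<in>S ` Reg. X \<inter> C s) = X - ?M"
      proof -
        have "(\<Union>s\<in>S ` Reg. X \<inter> C s) = X \<inter> Reg" by (auto simp: C_def)
        moreover have "Reg = - ?M" by (auto simp: Reg_def inner_commute)
        ultimately show ?thesis by (simp add: Diff_eq)
      qed
      ultimately show ?thesis using measure_Diff_null_set[of X lborel ?M] X(1) by simp
    qed
    ultimately show "measure lborel X = card (S ` Reg) * measure lborel (X \<inter> chamber)" by simp
  qed
qed

end

section \<open>Support functions and the \<open>L0_sum\<close>\<close>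

lemma support_function_upper:
  assumes "compact K" "y \<in> K"
  shows "u \<bullet> y \<le> support_function K u"
proof -
  have "compact ((\<bullet>) u ` K)" using assms(1) by (intro compact_continuous_image continuous_intros)
  then have "bdd_above ((\<bullet>) u ` K)" by (simp add: bounded_imp_bdd_above compact_imp_bounded)
  then show ?thesis unfolding support_function_def using assms(2) by (rule cSUP_upper2) simp
qed

lemma support_function_orthogonal:
  assumes "orthogonal_transformation g" "g ` K = K"
  shows "support_function K (g u) = support_function K u"
proof -
  have "(\<lambda>y. g u \<bullet> y) ` K = (\<lambda>y. g u \<bullet> y) ` g ` K" using assms(2) by simp
  also have "\<dots> = (\<lambda>y. u \<bullet> y) ` K"
    using assms(1) by (simp add: image_image orthogonal_transformation_def)
  finally show ?thesis by (simp add: support_function_def)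
qed

lemma closed_L0_sum: "closed (L0_sum t K L)"
proof -
  have "L0_sum t K L = (\<Inter>u\<in>sphere 0 1. {x. u \<bullet> x \<le> support_function K u powr (1 - t) * support_function L u powr t})"
    by (auto simp: L0_sum_def inner_commute)
  then show ?thesis by (auto intro!: closed_INT closed_halfspace_le)
qed

text \<open>The directions b and -b for b in \<open>Basis\<close> already confine the sum to a
  box.\<close>

lemma bounded_L0_sum: "bounded (L0_sum t K L)"
proof -
  let ?f = "\<lambda>u. support_function K u powr (1 - t) * support_function L u powr t"
  have "L0_sum t K L \<subseteq> cbox (\<Sum>b\<in>Basis. (- ?f (- b)) *\<^sub>R b) (\<Sum>b\<in>Basis. ?f b *\<^sub>R b)"
  proof
    fix x assume x: "x \<in> L0_sum t K L"
    have "x \<bullet> b \<le> ?f b" "- ?f (- b) \<le> x \<bullet> b" if "b \<in> Basis" for b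
    proof -
      have "b \<in> sphere 0 1" "- b \<in> sphere 0 1" using that by simp_all
      then have "x \<bullet> b \<le> ?f b" "x \<bullet> (- b) \<le> ?f (- b)" using x unfolding L0_sum_def by blast+
      then show "x \<bullet> b \<le> ?f b" "- ?f (- b) \<le> x \<bullet> b" by simp_all
    qed
    then show "x \<in> cbox (\<Sum>b\<in>Basis. (- ?f (- b)) *\<^sub>R b) (\<Sum>b\<in>Basis. ?f b *\<^sub>R b)"
      by (simp add: mem_box inner_sum_left inner_Basis if_distrib sum.delta cong: if_cong)
  qed
  then show ?thesis by (rule bounded_subset[OF bounded_cbox])
qed

lemma L0_sum_orthogonal:
  assumes g: "orthogonal_transformation g" and inv: "\<And>x. g (g x) = x" and "g ` K = K" "g ` L = L"
  shows "g ` L0_sum t K L = L0_sum t K L"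
proof (rule image_involution_eq[OF inv])
  fix x assume x: "x \<in> L0_sum t K L"
  have "g x \<bullet> u \<le> support_function K u powr (1 - t) * support_function L u powr t"
    if "u \<in> sphere 0 1" for u
  proof -
    have "g x \<bullet> u = g (g x) \<bullet> g u" using g by (simp add: orthogonal_transformation_def)
    moreover have "g u \<in> sphere 0 1" using that orthogonal_transformation_norm[OF g] by simp
    then have "x \<bullet> g u \<le> support_function K (g u) powr (1 - t) * support_function L (g u) powr t"
      using x unfolding L0_sum_def by blast
    ultimately show ?thesis by (simp add: inv support_function_orthogonal[OF g] assms(3,4))
  qed
  then show "g x \<in> L0_sum t K L" by (simp add: L0_sum_def)
qed

context root_chamber
begin

text \<open>Only directions \<open>u\<close> in the closed chamber need to be tested: moving \<open>u\<close> into it does not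
  decrease its product with a point of the chamber and leaves both support functions unchanged.\<close>

lemma measure_L0_sum_chamber:
  assumes t: "0 < t" "t < 1" and K: "compact K" "\<And>\<alpha>. \<alpha> \<in> \<Phi> \<Longrightarrow> reflection \<alpha> ` K = K"
    and L: "compact L" "\<And>\<alpha>. \<alpha> \<in> \<Phi> \<Longrightarrow> reflection \<alpha> ` L = L"
  shows "measure lborel (K \<inter> chamber) powr (1 - t) * measure lborel (L \<inter> chamber) powr t
     \<le> measure lborel (L0_sum t K L \<inter> chamber)"
proof -
  obtain T :: "'a \<Rightarrow> 'a" where T: "linear T" "inj T"
    and chamber_T: "\<And>w. w \<in> chamber \<longleftrightarrow> (\<forall>b\<in>Basis. 0 < T w \<bullet> b)"
    and dual: "\<And>u. (\<And>\<alpha>. \<alpha> \<in> positive_roots \<Longrightarrow> 0 \<le> u \<bullet> \<alpha>) \<Longrightarrow>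
       \<exists>c. (\<forall>b\<in>Basis. 0 \<le> c b) \<and> (\<forall>x. x \<bullet> u = (\<Sum>b\<in>Basis. c b * (T x \<bullet> b)))"
    using chamber_coordinates by blast
  obtain g where g: "linear g" "\<And>x. g (T x) = x" "\<And>x. T (g x) = x"
    using linear_injective_isomorphism[OF T] by auto
  obtain m where m: "0 < m" "\<And>A. A \<in> sets borel \<Longrightarrow> measure lborel (T -` A) = m * measure lborel A"
    using measure_linear_vimage[OF T] by blast
  have [measurable]: "g \<in> borel_measurable borel"
    using g(1) by (intro borel_measurable_continuous_onI linear_continuous_on linear_conv_bounded_linear[THEN iffD1])
  \<comment> \<open>A preimage under \<open>g\<close> is an image under \<open>T\<close>, that is,
    the set in chamber coordinates; the volume ratio \<open>m\<close> is the same for every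
    set.\<close>
  have vol: "g -` A \<in> sets borel" "measure lborel A = m * measure lborel (g -` A)" if "A \<in> sets borel" for A
  proof -
    show b: "g -` A \<in> sets borel" using measurable_sets[of g borel borel A] that by simp
    have "T -` g -` A = A" using g(2) by auto
    then show "measure lborel A = m * measure lborel (g -` A)" using m(2)[OF b] by simp
  qed
  have bdd: "bounded (g -` A)" if "bounded A" for A
    unfolding vimage_eq_image_inverse[of T g, OF g(3,2)]
    using that T(1) by (simp add: bounded_linear_image linear_conv_bounded_linear)
  let ?A = "K \<inter> chamber" and ?B = "L \<inter> chamber" and ?D = "L0_sum t K L \<inter> chamber"
  have borel: "?A \<in> sets borel" "?B \<in> sets borel" "?D \<in> sets borel"
    by (simp_all add: sets.Int borel_compact K(1) L(1) borel_closed closed_L0_sum borel_open chamber_open)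
  have bounded: "bounded ?A" "bounded ?B" "bounded ?D"
    using compact_imp_bounded[OF K(1)] compact_imp_bounded[OF L(1)] bounded_L0_sum[of t K L]
    by (auto intro: bounded_subset[OF _ Int_lower1])
  have "measure lborel (g -` ?A) powr (1 - t) * measure lborel (g -` ?B) powr t \<le> measure lborel (g -` ?D)"
  proof (rule prekopa_leindler_sets_mult[OF t vol(1)[OF borel(1)] vol(1)[OF borel(2)] vol(1)[OF borel(3)]
        bdd[OF bounded(1)] bdd[OF bounded(2)] bdd[OF bounded(3)]])
    show "0 < x \<bullet> b" if "x \<in> g -` ?A \<union> g -` ?B \<union> g -` ?D" "b \<in> Basis" for x b
      using that chamber_T[of "g x"] by (auto simp: g(3))
    fix x y assume x: "x \<in> g -` ?A" and y: "y \<in> g -` ?B"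
    define z' where "z' = (\<Sum>b\<in>Basis. ((x \<bullet> b) powr (1 - t) * (y \<bullet> b) powr t) *\<^sub>R b)"
    have z': "z' \<bullet> b = (x \<bullet> b) powr (1 - t) * (y \<bullet> b) powr t" if "b \<in> Basis" for b
      using that by (simp add: z'_def inner_sum_left inner_Basis if_distrib sum.delta cong: if_cong)
    have xy: "0 < x \<bullet> b" "0 < y \<bullet> b" if "b \<in> Basis" for b
      using that x y chamber_T[of "g x"] chamber_T[of "g y"] by (auto simp: g(3))
    have gz: "g z' \<in> chamber"
      unfolding chamber_T g(3)
    proof
      fix b :: 'a assume b: "b \<in> Basis"
      show "0 < z' \<bullet> b" using xy[OF b] unfolding z'[OF b] by (intro mult_pos_pos) auto
    qed
    have "g z' \<bullet> u \<le> support_function K u powr (1 - t) * support_function L u powr t" for u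
    proof -
      have inv: "reflection \<alpha> ` X = X" if "\<alpha> \<in> \<Phi>" "X \<in> {K, L}" for \<alpha> X
        using that(2) K(2)[OF that(1)] L(2)[OF that(1)] by (metis empty_iff insert_iff)
      obtain h where h: "h \<in> symmetries {K, L}" "g z' \<bullet> u \<le> g z' \<bullet> h u"
        and pos: "\<And>\<alpha>. \<alpha> \<in> positive_roots \<Longrightarrow> 0 \<le> h u \<bullet> \<alpha>"
        using move_to_chamber[OF inv gz, of "{K, L}" u] by blast
      obtain c where c: "\<And>b. b \<in> Basis \<Longrightarrow> 0 \<le> c b" "\<And>v. v \<bullet> h u = (\<Sum>b\<in>Basis. c b * (T v \<bullet> b))"
        using dual[OF pos] by blast
      have gu: "g v \<bullet> h u = (\<Sum>b\<in>Basis. c b * (v \<bullet> b))" for v unfolding c(2) g(3) ..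
      have "g z' \<bullet> u \<le> (\<Sum>b\<in>Basis. c b * (z' \<bullet> b))" using h(2) unfolding gu .
      \<comment> \<open>Since the weights \<open>c b\<close> are nonnegative they can be moved
        inside the geometric means, which prepares Hoelder for sums that equal the products of g x
        and g y with \<open>h u\<close>.\<close>
      also have "\<dots> = (\<Sum>b\<in>Basis. (c b * (x \<bullet> b)) powr (1 - t) * (c b * (y \<bullet> b)) powr t)"
      proof (rule sum.cong[OF refl])
        fix b :: 'a assume b: "b \<in> Basis"
        show "c b * (z' \<bullet> b) = (c b * (x \<bullet> b)) powr (1 - t) * (c b * (y \<bullet> b)) powr t"
          unfolding z'[OF b] weighted_mean_mult[OF c(1)[OF b]] ..
      qed
      also have "\<dots> \<le> (\<Sum>b\<in>Basis. c b * (x \<bullet> b)) powr (1 - t) * (\<Sum>b\<in>Basis. c b * (y \<bullet> b)) powr t"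
        using c(1) xy by (intro sum_powr_Holder[OF t]) (auto simp: less_imp_le)
      also have "\<dots> \<le> support_function K (h u) powr (1 - t) * support_function L (h u) powr t"
      proof (intro mult_mono powr_mono2)
        show "(\<Sum>b\<in>Basis. c b * (x \<bullet> b)) \<le> support_function K (h u)"
          using support_function_upper[OF K(1), of "g x" "h u"] x unfolding gu[symmetric] by (simp add: inner_commute)
        show "(\<Sum>b\<in>Basis. c b * (y \<bullet> b)) \<le> support_function L (h u)"
          using support_function_upper[OF L(1), of "g y" "h u"] y unfolding gu[symmetric] by (simp add: inner_commute)
        show "0 \<le> (\<Sum>b\<in>Basis. c b * (x \<bullet> b))" "0 \<le> (\<Sum>b\<in>Basis. c b * (y \<bullet> b))"
          using c(1) xy by (auto intro!: sum_nonneg mult_nonneg_nonneg simp: less_imp_le)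
      qed (use t in auto)
      also have "\<dots> = support_function K u powr (1 - t) * support_function L u powr t"
        using h(1) by (simp add: symmetries_def support_function_orthogonal)
      finally show ?thesis .
    qed
    then show "(\<Sum>b\<in>Basis. ((x \<bullet> b) powr (1 - t) * (y \<bullet> b) powr t) *\<^sub>R b) \<in> g -` ?D"
      using gz by (simp add: L0_sum_def flip: z'_def)
  qed
  then show ?thesis
    unfolding vol(2)[OF borel(1)] vol(2)[OF borel(2)] vol(2)[OF borel(3)] weighted_mean_mult[OF less_imp_le[OF m(1)]]
    using m(1) by (intro mult_left_mono) auto
qed

end

text \<open>The sum inherits the reflections of K and L, so all three volumes are the same multiple
  of their parts in one chamber.\<close>

lemma (in root_system) log_brunn_minkowski:
  assumes t: "0 < t" "t < 1" and K: "compact K" "\<And>\<alpha>. \<alpha> \<in> \<Phi> \<Longrightarrow> reflection \<alpha> ` K = K"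
    and L: "compact L" "\<And>\<alpha>. \<alpha> \<in> \<Phi> \<Longrightarrow> reflection \<alpha> ` L = L"
  shows "measure lborel K powr (1 - t) * measure lborel L powr t \<le> measure lborel (L0_sum t K L)"
proof -
  obtain z where "\<And>\<alpha>. \<alpha> \<in> \<Phi> \<Longrightarrow> z \<bullet> \<alpha> \<noteq> 0" using regular_exists by blast
  then interpret root_chamber \<Phi> z by unfold_locales
  obtain N :: nat where N: "0 < N" and meas: "\<And>X. X \<in> sets borel \<Longrightarrow> bounded X \<Longrightarrow>
      (\<And>\<alpha>. \<alpha> \<in> \<Phi> \<Longrightarrow> reflection \<alpha> ` X = X) \<Longrightarrow> measure lborel X = N * measure lborel (X \<inter> chamber)"
    using measure_eq_chambers by blast
  have K': "measure lborel K = N * measure lborel (K \<inter> chamber)"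
    using K by (intro meas) (auto simp: borel_compact compact_imp_bounded)
  have L': "measure lborel L = N * measure lborel (L \<inter> chamber)"
    using L by (intro meas) (auto simp: borel_compact compact_imp_bounded)
  have "reflection \<alpha> ` L0_sum t K L = L0_sum t K L" if "\<alpha> \<in> \<Phi>" for \<alpha>
    using that K(2) L(2) unit_root[OF that]
    by (intro L0_sum_orthogonal orthogonal_reflection reflection_involution) auto
  then have M': "measure lborel (L0_sum t K L) = N * measure lborel (L0_sum t K L \<inter> chamber)"
    by (intro meas bounded_L0_sum) (auto simp: closed_L0_sum borel_closed)
  show ?thesis
    unfolding K' L' M' weighted_mean_mult[OF of_nat_0_le_iff]
    by (intro mult_left_mono measure_L0_sum_chamber t K L) auto
qed

section \<open>Reflections of a regular polytope\<close>

text \<open>For a nonempty polytope a positive multiple of the vertex centroid. Dropping the factor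
  changes neither spans nor fixed vectors, and \<open>centered_at_origin\<close> becomes the
  vanishing of this sum.\<close>

definition vertex_sum :: "'a::euclidean_space set \<Rightarrow> 'a" where
  "vertex_sum F = (\<Sum>v | v extreme_point_of F. v)"

lemma finite_vertices:
  fixes F :: "'a::euclidean_space set"
  shows "polytope F \<Longrightarrow> finite {v. v extreme_point_of F}"
  by (simp add: finite_polyhedron_extreme_points polytope_imp_polyhedron)

lemma convex_hull_vertices:
  fixes F :: "'a::euclidean_space set"
  shows "polytope F \<Longrightarrow> convex hull {v. v extreme_point_of F} = F"
  using Krein_Milman_Minkowski[of F] by (simp add: polytope_imp_compact polytope_imp_convex)

lemma vertices_nonempty:
  fixes F :: "'a::euclidean_space set"
  shows "polytope F \<Longrightarrow> F \<noteq> {} \<Longrightarrow> {v. v extreme_point_of F} \<noteq> {}"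
  using convex_hull_vertices by fastforce

lemma extreme_points_linear_image:
  assumes "linear f" "inj f"
  shows "{v. v extreme_point_of f ` S} = f ` {v. v extreme_point_of S}"
proof -
  have "f v extreme_point_of f ` S \<longleftrightarrow> v extreme_point_of S" for v
    using face_of_linear_image[OF assms, of "{v}" S] by (simp add: face_of_singleton)
  moreover have "\<exists>v. w = f v" if "w extreme_point_of f ` S" for w
    using that by (auto simp: extreme_point_of_def)
  ultimately show ?thesis by blast
qed

lemma vertex_sum_linear_image:
  assumes "linear f" "inj f"
  shows "vertex_sum (f ` F) = f (vertex_sum F)"
  unfolding vertex_sum_def extreme_points_linear_image[OF assms]
  using assms(2) by (subst sum.reindex) (auto simp: linear_sum[OF assms(1)] inj_on_def)

lemma centroid_mem:
  assumes "convex S" "finite V" "V \<noteq> {}" "V \<subseteq> S"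
  shows "(1 / real (card V)) *\<^sub>R (\<Sum>v\<in>V. v) \<in> S"
proof -
  have "(\<Sum>v\<in>V. (1 / real (card V)) *\<^sub>R v) \<in> S"
    using assms by (intro convex_sum) auto
  then show ?thesis by (simp add: scaleR_right.sum)
qed

text \<open>The centroid lies strictly between any v in \<open>V\<close> and the centroid of the
  other points, so the defining property of a face pulls v into \<open>F\<close>.\<close>

lemma centroid_in_face:
  assumes S: "convex S" and F: "F face_of S" and V: "finite V" "V \<noteq> {}" "V \<subseteq> S"
    and c: "(1 / real (card V)) *\<^sub>R (\<Sum>v\<in>V. v) \<in> F"
  shows "V \<subseteq> F"
proof
  fix v assume v: "v \<in> V"
  show "v \<in> F"
  proof (cases "V = {v}")
    case True
    then show ?thesis using c by simp
  next
    case False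
    define n where "n = real (card V)"
    define w where "w = (1 / real (card (V - {v}))) *\<^sub>R (\<Sum>u\<in>V - {v}. u)"
    have ne: "V - {v} \<noteq> {}" using False v by blast
    then have "card (V - {v}) > 0" using V by (simp add: card_gt_0_iff)
    then have n: "1 < n" "real (card (V - {v})) = n - 1" using V v by (auto simp: n_def)
    have w: "w \<in> S" unfolding w_def using V ne by (intro centroid_mem S) auto
    have "(\<Sum>u\<in>V - {v}. u) = (n - 1) *\<^sub>R w" using n by (simp add: w_def)
    then have "(1 / n) *\<^sub>R (\<Sum>u\<in>V. u) = (1 / n) *\<^sub>R (v + (n - 1) *\<^sub>R w)"
      using v V by (simp add: sum.remove)
    also have "\<dots> = (1 - 1 / n) *\<^sub>R w + (1 / n) *\<^sub>R v"
      using n by (simp add: scaleR_add_right diff_divide_distrib)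
    finally have eq: "(1 - 1 / n) *\<^sub>R w + (1 / n) *\<^sub>R v \<in> F" using c by (simp add: n_def)
    show ?thesis
    \<comment> \<open>Between coinciding points the open segment is empty, but then the centroid is
      v itself.\<close>
    proof (cases "w = v")
      case True
      then have "(1 - 1 / n) *\<^sub>R w + (1 / n) *\<^sub>R v = v" by (simp flip: scaleR_add_left)
      then show ?thesis using eq by simp
    next
      case False
      then have "(1 - 1 / n) *\<^sub>R w + (1 / n) *\<^sub>R v \<in> open_segment w v"
        using n by (auto simp: in_segment intro!: exI[of _ "1 / n"])
      then show ?thesis using face_ofD[OF F _ w _ eq] v V by blast
    qed
  qed
qed

text \<open>An isometry is a translation by g 0 after a linear orthogonal map f. It permutes the
  vertices; summing them and using that their sum is 0 leaves a multiple of g 0 by the number of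
  vertices, so g 0 = 0.\<close>

lemma symmetry_group_linear:
  assumes P: "polytope P" "P \<noteq> {}" "centered_at_origin P" and g: "g \<in> symmetry_group P"
  shows "orthogonal_transformation g" "g ` P = P"
proof -
  show gP: "g ` P = P" using g by (simp add: symmetry_group_def)
  define f where "f x = g x - g 0" for x
  have f: "orthogonal_transformation f"
    using g by (auto simp: orthogonal_transformation_isometry f_def symmetry_group_def dist_norm)
  have g_eq: "g x = g 0 + f x" for x by (simp add: f_def)
  let ?V = "{v. v extreme_point_of P}"
  have "P = (+) (g 0) ` f ` P" unfolding image_image g_eq[symmetric] using gP by simp
  then have "?V = (+) (g 0) ` f ` ?V"
    using extreme_points_of_translation[of "g 0" "f ` P"]
      extreme_points_linear_image[OF orthogonal_transformation_linear[OF f] orthogonal_transformation_inj[OF f], of P] by simp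
  then have V: "?V = g ` ?V" unfolding image_image g_eq[symmetric] .
  have inj: "inj_on g ?V" using orthogonal_transformation_inj[OF f] by (auto simp: inj_on_def f_def)
  have lin: "linear f" using f by (rule orthogonal_transformation_linear)
  have "0 = (\<Sum>v\<in>?V. v)" using P(3) by (simp add: centered_at_origin_def)
  also have "\<dots> = (\<Sum>v\<in>g ` ?V. v)" using V by simp
  also have "\<dots> = (\<Sum>v\<in>?V. g 0 + f v)" unfolding g_eq[symmetric] using inj by (simp add: sum.reindex)
  also have "\<dots> = real (card ?V) *\<^sub>R g 0 + f (\<Sum>v\<in>?V. v)"
    by (simp add: sum.distrib linear_sum[OF lin] sum_constant_scaleR)
  also have "(\<Sum>v\<in>?V. v) = 0" using P(3) by (simp add: centered_at_origin_def)
  finally have "real (card ?V) *\<^sub>R g 0 = 0" using linear_0[OF lin] by simp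
  moreover have "card ?V \<noteq> 0" using finite_vertices[OF P(1)] vertices_nonempty[OF P(1,2)] by simp
  ultimately have "g 0 = 0" by simp
  then have "g = f" by (simp add: f_def fun_eq_iff)
  then show "orthogonal_transformation g" using f by simp
qed

section \<open>Flags of faces\<close>

text \<open>Indices are shifted by one: \<open>F 0\<close> is the empty face, of affine dimension \<open>-1\<close>.\<close>

definition full_flag :: "'a::euclidean_space set \<Rightarrow> (nat \<Rightarrow> 'a set) \<Rightarrow> bool" where
  "full_flag P F \<longleftrightarrow> F (Suc (nat (aff_dim P))) = P \<and> (\<forall>i\<le>Suc (nat (aff_dim P)). aff_dim (F i) = int i - 1)
     \<and> (\<forall>i\<le>nat (aff_dim P). F i face_of F (Suc i))"

lemma full_flag_exists:
  assumes "polytope P" "P \<noteq> {}"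
  shows "\<exists>F. full_flag P F"
  using assms
proof (induction "nat (aff_dim P)" arbitrary: P)
  case 0
  then have "aff_dim P = 0" using aff_dim_geq[of P] aff_dim_empty[of P] by linarith
  then have "full_flag P (\<lambda>i. if i = 0 then {} else P)"
    unfolding full_flag_def by simp
  then show ?case by blast
next
  case (Suc n)
  have dimP: "aff_dim P = int (Suc n)" using Suc(2) by linarith
  obtain Q where Q: "Q facet_of P"
    by (rule polytope_facet_exists[OF Suc.prems(1)]) (use dimP in auto)
  have dim: "aff_dim P = int (Suc n)" "aff_dim Q = int n" using Q dimP by (auto simp: facet_of_def)
  have "polytope Q" "Q \<noteq> {}" using Q Suc.prems face_of_polytope_polytope by (auto simp: facet_of_def)
  then obtain F where F: "full_flag Q F" using Suc(1)[of Q] dim by auto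
  have nat: "nat (aff_dim P) = Suc n" "nat (aff_dim Q) = n" using dim by simp_all
  have F': "F (Suc n) = Q" "\<And>i. i \<le> Suc n \<Longrightarrow> aff_dim (F i) = int i - 1" "\<And>i. i \<le> n \<Longrightarrow> F i face_of F (Suc i)"
    using F unfolding full_flag_def nat by simp_all
  have "Q face_of P" using Q by (rule facet_of_imp_face_of)
  have "full_flag P (\<lambda>i. if i = Suc (Suc n) then P else F i)"
    unfolding full_flag_def nat
  proof (intro conjI allI impI)
    fix i assume "i \<le> Suc (Suc n)"
    then show "aff_dim (if i = Suc (Suc n) then P else F i) = int i - 1" using dim(1) F'(2) by simp
  next
    fix i assume i: "i \<le> Suc n"
    then show "(if i = Suc (Suc n) then P else F i) face_of (if Suc i = Suc (Suc n) then P else F (Suc i))"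
      using F'(1) F'(3)[of i] \<open>Q face_of P\<close> by (cases "i = Suc n") auto
  qed simp
  then show ?case by blast
qed

lemma full_flag_mono:
  assumes "full_flag P F" "i \<le> j" "j \<le> Suc (nat (aff_dim P))" and "convex P"
  shows "F i face_of F j"
  using assms(2,3)
proof (induction j rule: dec_induct)
  case base
  have "F i face_of F i" if "i \<le> Suc (nat (aff_dim P))" for i
  proof (cases "i = Suc (nat (aff_dim P))")
    case True
    then show ?thesis using assms by (simp add: full_flag_def face_of_refl)
  next
    case False
    then have "F i face_of F (Suc i)" using assms(1) that by (simp add: full_flag_def)
    then show ?thesis by (simp add: face_of_refl face_of_imp_convex)
  qed
  then show ?case using base by blast
next
  case (step j)
  then show ?case using assms(1) by (auto simp: full_flag_def intro: face_of_trans)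
qed

text \<open>Maximality holds because every possible dimension already occurs: a further face
  comparable with the member of its own dimension would coincide with it.\<close>

lemma full_flag_in_flags:
  assumes F: "full_flag P F" and P: "convex P" "P \<noteq> {}"
  shows "F ` {..Suc (nat (aff_dim P))} \<in> flags P"
proof -
  let ?n = "nat (aff_dim P)" and ?A = "{F. F face_of P}"
  have n: "aff_dim P = int ?n" using P(2) aff_dim_geq[of P] aff_dim_empty[of P] by linarith
  have FP: "F i face_of P" if "i \<le> Suc ?n" for i
    using full_flag_mono[OF F that _ P(1)] F by (simp add: full_flag_def)
  have "X \<subseteq> Y \<or> Y \<subseteq> X" if XY: "X \<in> F ` {..Suc ?n}" "Y \<in> F ` {..Suc ?n}" for X Y
  proof -
    obtain i j where ij: "i \<le> Suc ?n" "j \<le> Suc ?n" "X = F i" "Y = F j" using XY by auto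
    show ?thesis
    proof (cases "i \<le> j")
      case True
      then show ?thesis using face_of_imp_subset[OF full_flag_mono[OF F True ij(2) P(1)]] ij by simp
    next
      case False
      then have "j \<le> i" by simp
      then show ?thesis using face_of_imp_subset[OF full_flag_mono[OF F _ ij(1) P(1)]] ij by simp
    qed
  qed
  then have chain: "subset.chain ?A (F ` {..Suc ?n})"
    unfolding subset_chain_def using FP by auto
  have "\<not> (subset.chain ?A \<Psi> \<and> F ` {..Suc ?n} \<subset> \<Psi>)" for \<Psi>
  proof
    assume "subset.chain ?A \<Psi> \<and> F ` {..Suc ?n} \<subset> \<Psi>"
    then obtain X where X: "X \<in> \<Psi>" "X \<notin> F ` {..Suc ?n}" and ch: "subset.chain ?A \<Psi>" "F ` {..Suc ?n} \<subseteq> \<Psi>" by blast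
    have Xf: "X face_of P" using X ch by (auto simp: subset_chain_def)
    have "aff_dim X \<le> aff_dim P" by (rule aff_dim_subset[OF face_of_imp_subset[OF Xf]])
    \<comment> \<open>The index of the member with the dimension of \<open>X\<close>; the empty face
      has index 0.\<close>
    then have i: "nat (aff_dim X + 1) \<le> Suc ?n" (is "?i \<le> _") using n by linarith
    have "aff_dim (F ?i) = aff_dim X"
      using F i aff_dim_geq[of X] by (simp add: full_flag_def)
    moreover have "F ?i \<in> \<Psi>" using i ch(2) by auto
    then have "X \<subseteq> F ?i \<or> F ?i \<subseteq> X" using ch(1) X(1) by (auto simp: subset_chain_def)
    moreover have "F ?i \<noteq> X" using X(2) i by auto
    ultimately show False
      using face_of_aff_dim_lt[of "F ?i" X] face_of_aff_dim_lt[of X "F ?i"]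
        face_of_subset[OF Xf _ face_of_imp_subset[OF FP[OF i]]] face_of_subset[OF FP[OF i] _ face_of_imp_subset[OF Xf]]
        face_of_imp_convex[OF Xf] face_of_imp_convex[OF FP[OF i]] by auto
  qed
  then show ?thesis using chain by (auto simp: flags_def subset.maxchain_def)
qed

text \<open>The existence half of the diamond property: the faces of a flag next to
  \<open>F k\<close> leave at least one other choice in its place.\<close>

lemma diamond:
  assumes P: "polytope P" and F: "full_flag P F" and k: "1 \<le> k" "k \<le> nat (aff_dim P)" and "P \<noteq> {}"
  obtains H where "H \<noteq> F k" "full_flag P (F(k := H))"
proof -
  let ?n = "nat (aff_dim P)"
  have cP: "convex P" using P by (rule polytope_imp_convex)
  have dim: "aff_dim (F i) = int i - 1" if "i \<le> Suc ?n" for i using F that by (simp add: full_flag_def)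
  obtain j where j: "k = Suc j" using k by (cases k) auto
  have f1: "F j face_of F k" and f2: "F k face_of F (Suc k)" using F k j by (simp_all add: full_flag_def)
  have poly: "polytope (F (Suc k))"
    using full_flag_mono[OF F, of "Suc k" "Suc ?n"] k cP F P face_of_polytope_polytope by (auto simp: full_flag_def)
  have "\<exists>H. H \<noteq> F k \<and> H face_of F (Suc k) \<and> F j \<subseteq> H \<and> aff_dim H = int k - 1"
  \<comment> \<open>If the lower neighbour is the empty face, the upper one is an edge and its other
    endpoint serves. Otherwise the lower neighbour is the intersection of the facets of
    \<open>F (Suc k)\<close> containing it, so \<open>F k\<close> cannot be the only such
    facet.\<close>
  proof (cases "j = 0")
    case True
    let ?V = "{v. v extreme_point_of F (Suc k)}"
    have d0: "aff_dim (F k) = 0" "aff_dim (F (Suc k)) = 1" using dim[of k] dim[of "Suc k"] k j True by auto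
    then obtain a where a: "F k = {a}" by (auto simp: aff_dim_eq_0)
    have "\<not> ?V \<subseteq> {a}"
    proof
      assume "?V \<subseteq> {a}"
      then have "convex hull ?V \<subseteq> {a}" by (simp add: hull_minimal)
      then have "aff_dim (F (Suc k)) \<le> aff_dim {a}"
        unfolding convex_hull_vertices[OF poly] by (rule aff_dim_subset)
      then show False using d0 by simp
    qed
    then obtain v where v: "v extreme_point_of F (Suc k)" "v \<noteq> a" by blast
    moreover have "F j = {}" using dim[of j] True by (simp add: aff_dim_empty[symmetric])
    ultimately show ?thesis
      using j True a by (intro exI[of _ "{v}"]) (auto simp: face_of_singleton)
  next
    case False
    have "F j \<noteq> {}" using dim[of j] k j False by auto
    have ne: "F j \<noteq> F k" "F j \<noteq> F (Suc k)" using dim[of j] dim[of k] dim[of "Suc k"] k j by auto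
    have f: "F j face_of F (Suc k)" using f1 f2 by (rule face_of_trans)
    have "\<not> (\<forall>H. H facet_of F (Suc k) \<and> F j \<subseteq> H \<longrightarrow> H = F k)"
    proof
      assume "\<forall>H. H facet_of F (Suc k) \<and> F j \<subseteq> H \<longrightarrow> H = F k"
      then have "F k \<subseteq> \<Inter>{H. H facet_of F (Suc k) \<and> F j \<subseteq> H}" by blast
      then have "F k \<subseteq> F j"
        using face_of_polyhedron[OF polytope_imp_polyhedron[OF poly] f \<open>F j \<noteq> {}\<close> ne(2)] by simp
      then show False using face_of_imp_subset[OF f1] ne(1) by blast
    qed
    then obtain H where "H facet_of F (Suc k)" "F j \<subseteq> H" "H \<noteq> F k" by blast
    then show ?thesis using dim[of "Suc k"] k by (intro exI[of _ H]) (auto simp: facet_of_def)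
  qed
  then obtain H where H: "H \<noteq> F k" "H face_of F (Suc k)" "F j \<subseteq> H" "aff_dim H = int k - 1" by blast
  have "F j face_of H"
    using face_of_subset[OF face_of_trans[OF f1 f2] H(3) face_of_imp_subset[OF H(2)]] .
  then have "full_flag P (F(k := H))"
    using F H k j unfolding full_flag_def by auto
  then show ?thesis using H(1) that by blast
qed

text \<open>Each vertex centroid lies off the affine hull of the previous face, and the dimension
  grows by one per step, so adding it affinely generates the next face.\<close>

lemma full_flag_span:
  assumes P: "polytope P" "P \<noteq> {}" and F: "full_flag P F" and "i \<le> Suc (nat (aff_dim P))"
  shows "F i \<subseteq> span ((\<lambda>j. vertex_sum (F j)) ` {1..i})"
  using assms(4)
proof (induction i)
  case 0
  have "aff_dim (F 0) = -1" using F by (simp add: full_flag_def)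
  then show ?case by (simp add: aff_dim_empty[symmetric])
next
  case (Suc i)
  let ?V = "{v. v extreme_point_of F (Suc i)}"
  have dim: "aff_dim (F (Suc i)) = int i" "aff_dim (F i) = int i - 1"
    using F Suc.prems by (simp_all add: full_flag_def)
  have face: "F i face_of F (Suc i)" using F Suc.prems by (simp add: full_flag_def)
  have "F (Suc i) face_of P"
    using full_flag_mono[OF F Suc.prems order_refl polytope_imp_convex[OF P(1)]] F by (simp add: full_flag_def)
  then have poly: "polytope (F (Suc i))" using P(1) face_of_polytope_polytope by blast
  have conv: "convex (F (Suc i))" using poly by (rule polytope_imp_convex)
  have ne: "F (Suc i) \<noteq> {}" using dim(1) by auto
  have V: "finite ?V" "?V \<noteq> {}" "?V \<subseteq> F (Suc i)"
    using finite_vertices[OF poly] vertices_nonempty[OF poly ne] by (auto simp: extreme_point_of_def)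
  define c where "c = (1 / real (card ?V)) *\<^sub>R vertex_sum (F (Suc i))"
  have c: "c \<in> F (Suc i)"
    using centroid_mem[OF conv V] by (simp add: c_def vertex_sum_def)
  \<comment> \<open>A face containing the centroid contains all vertices, and would be the whole of
    \<open>F (Suc i)\<close>.\<close>
  have "c \<notin> F i"
  proof
    assume "c \<in> F i"
    then have "?V \<subseteq> F i" using centroid_in_face[OF conv face V] by (simp add: c_def vertex_sum_def)
    then have "F (Suc i) \<subseteq> F i"
      using hull_minimal[of ?V "F i" convex] face_of_imp_convex[OF face] convex_hull_vertices[OF poly] by simp
    then have "F (Suc i) = F i" using face_of_imp_subset[OF face] by blast
    then show False using dim by simp
  qed
  then have "c \<notin> affine hull F i" using face_of_imp_eq_affine_Int[OF conv face] c by blast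
  then have dimc: "aff_dim (insert c (F i)) = aff_dim (F (Suc i))" using dim by (simp add: aff_dim_insert)
  have "affine hull (insert c (F i)) = affine hull F (Suc i)"
  proof (rule affine_dim_equal)
    show "affine hull insert c (F i) \<subseteq> affine hull F (Suc i)"
      using c face_of_imp_subset[OF face] by (intro hull_mono) auto
  qed (use dimc in auto)
  moreover have "affine hull (insert c (F i)) \<subseteq> span ((\<lambda>j. vertex_sum (F j)) ` {1..Suc i})"
  proof (rule hull_minimal)
    have "span ((\<lambda>j. vertex_sum (F j)) ` {1..i}) \<subseteq> span ((\<lambda>j. vertex_sum (F j)) ` {1..Suc i})"
      by (intro span_mono image_mono) auto
    moreover have "c \<in> span ((\<lambda>j. vertex_sum (F j)) ` {1..Suc i})"
      unfolding c_def by (intro span_scale span_base imageI) auto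
    ultimately show "insert c (F i) \<subseteq> span ((\<lambda>j. vertex_sum (F j)) ` {1..Suc i})"
      using Suc.IH Suc.prems by auto
  qed (simp add: subspace_imp_affine)
  ultimately show ?case using hull_subset[of "F (Suc i)" affine] by blast
qed

text \<open>Coefficients are attached to indices rather than to vectors, so \<open>b\<close> may
  take a value more than once.\<close>

lemma span_image_finite_sum:
  fixes b :: "'i \<Rightarrow> 'a::real_vector"
  assumes "finite I" "y \<in> span (b ` I)"
  obtains r where "y = (\<Sum>i\<in>I. r i *\<^sub>R b i)"
proof -
  let ?S = "{y. \<exists>r. y = (\<Sum>i\<in>I. r i *\<^sub>R b i)}"
  have "span (b ` I) \<subseteq> ?S"
  proof (rule span_minimal)
    show "b ` I \<subseteq> ?S"
    proof
      fix x assume "x \<in> b ` I"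
      then obtain j where j: "j \<in> I" "x = b j" by blast
      then have "x = (\<Sum>i\<in>I. (if i = j then 1 else 0) *\<^sub>R b i)"
        using assms(1) by (simp add: if_distrib[of "\<lambda>c. c *\<^sub>R _"] cong: if_cong)
      then show "x \<in> ?S" by (intro CollectI exI[of _ "\<lambda>i. if i = j then 1 else 0"])
    qed
    show "subspace ?S"
    proof (rule subspaceI)
      show "0 \<in> ?S" by (intro CollectI exI[of _ "\<lambda>_. 0"]) simp
      show "x + y \<in> ?S" if xy: "x \<in> ?S" "y \<in> ?S" for x y
      proof -
        obtain r s where "x = (\<Sum>i\<in>I. r i *\<^sub>R b i)" "y = (\<Sum>i\<in>I. s i *\<^sub>R b i)" using xy by blast
        then have "x + y = (\<Sum>i\<in>I. (r i + s i) *\<^sub>R b i)" by (simp add: scaleR_add_left sum.distrib)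
        then show ?thesis by (intro CollectI exI[of _ "\<lambda>i. r i + s i"])
      qed
      show "c *\<^sub>R x \<in> ?S" if x: "x \<in> ?S" for c x
      proof -
        obtain r where "x = (\<Sum>i\<in>I. r i *\<^sub>R b i)" using x by blast
        then have "c *\<^sub>R x = (\<Sum>i\<in>I. (c * r i) *\<^sub>R b i)" by (simp add: scaleR_right.sum)
        then show ?thesis by (intro CollectI exI[of _ "\<lambda>i. c * r i"])
      qed
    qed
  qed
  then show ?thesis using assms(2) that by blast
qed

text \<open>Put a = b - g b. Each fixed x satisfies x \<bullet> g b = g x \<bullet> g b = x
  \<bullet> b, so x is orthogonal to a and fixed by the reflection. As b and g b have equal length,
  a \<bullet> a = 2 (b \<bullet> a), so the reflection also sends b to b - a = g b.\<close>

lemma orthogonal_eq_reflection: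
  assumes g: "orthogonal_transformation g" and span: "span (insert b B) = UNIV"
    and fixed: "\<And>x. x \<in> B \<Longrightarrow> g x = x" and ne: "g b \<noteq> b"
  shows "g = reflection (sgn (b - g b))"
proof -
  define a where "a = b - g b"
  have inner: "g x \<bullet> g y = x \<bullet> y" for x y using g by (simp add: orthogonal_transformation_def)
  have refl: "reflection (sgn a) x = x - (2 * (x \<bullet> a) / (a \<bullet> a)) *\<^sub>R a" for x
    by (simp add: reflection_def sgn_div_norm dot_square_norm power2_eq_square divide_simps)
  have aa: "a \<bullet> a = 2 * (b \<bullet> a)"
    using inner[of b b] by (simp add: a_def algebra_simps inner_commute)
  have "a \<bullet> a \<noteq> 0" using ne by (simp add: a_def)
  have "g x = reflection (sgn a) x" for x
  proof (rule linear_eq_on_span[of g "reflection (sgn a)" "insert b B"])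
    fix x assume "x \<in> insert b B"
    then show "g x = reflection (sgn a) x"
    proof
      assume "x = b"
      then show ?thesis using aa \<open>a \<bullet> a \<noteq> 0\<close> by (simp add: refl) (simp add: a_def)
    next
      assume "x \<in> B"
      then have "x \<bullet> a = 0" using inner[of x b] fixed[of x] by (simp add: a_def inner_diff_right)
      then show ?thesis using fixed[OF \<open>x \<in> B\<close>] by (simp add: refl)
    qed
  qed (use span g in \<open>auto simp: linear_reflection orthogonal_transformation_linear\<close>)
  then show ?thesis unfolding a_def[symmetric] by (rule ext)
qed

section \<open>The root system of a regular polytope\<close>

definition symmetry_roots :: "'a::euclidean_space set \<Rightarrow> 'a set" where
  "symmetry_roots P = {\<alpha>. norm \<alpha> = 1 \<and> reflection \<alpha> \<in> symmetry_group P}"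

lemma symmetry_group_comp:
  "g \<in> symmetry_group P \<Longrightarrow> h \<in> symmetry_group P \<Longrightarrow> (\<lambda>x. g (h x)) \<in> symmetry_group P"
  using image_image[of g h P] by (simp add: symmetry_group_def)

text \<open>Shows that the roots are closed under reflection: the mirror of the reflected root
  belongs to a conjugate, which is again a symmetry.\<close>

lemma reflection_conjugate:
  assumes "norm \<alpha> = 1"
  shows "reflection (reflection \<alpha> \<beta>) = (\<lambda>x. reflection \<alpha> (reflection \<beta> (reflection \<alpha> x)))"
proof
  fix x
  have "reflection \<alpha> (reflection \<beta> (reflection \<alpha> x))
      = reflection \<alpha> (reflection \<alpha> x) - (2 * (reflection \<alpha> x \<bullet> \<beta>)) *\<^sub>R reflection \<alpha> \<beta>"
    unfolding reflection_def[of \<beta>] by (simp add: linear_diff[OF linear_reflection] linear_scale[OF linear_reflection])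
  then show "reflection (reflection \<alpha> \<beta>) x = reflection \<alpha> (reflection \<beta> (reflection \<alpha> x))"
    by (simp add: reflection_involution[OF assms] inner_reflection reflection_def[of "reflection \<alpha> \<beta>"])
qed

text \<open>Each root is the normalised difference of a vertex off its mirror and the image of that
  vertex, and there are finitely many pairs of vertices. Such a vertex exists because a polytope
  with interior points is not contained in a hyperplane.\<close>

lemma finite_symmetry_roots:
  assumes P: "polytope P" "interior P \<noteq> {}"
  shows "finite (symmetry_roots P)"
proof -
  let ?V = "{v. v extreme_point_of P}"
  have "symmetry_roots P \<subseteq> (\<lambda>(v, w). sgn (v - w)) ` (?V \<times> ?V)"
  proof
    fix \<alpha> assume \<alpha>: "\<alpha> \<in> symmetry_roots P"
    then have n: "norm \<alpha> = 1" and rP: "reflection \<alpha> ` P = P" by (auto simp: symmetry_roots_def symmetry_group_def)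
    have "\<exists>v\<in>?V. v \<bullet> \<alpha> \<noteq> 0"
    proof (rule ccontr)
      assume "\<not> (\<exists>v\<in>?V. v \<bullet> \<alpha> \<noteq> 0)"
      then have "?V \<subseteq> {x. \<alpha> \<bullet> x = 0}" by (auto simp: inner_commute)
      then have "P \<subseteq> {x. \<alpha> \<bullet> x = 0}"
        using hull_minimal[of ?V "{x. \<alpha> \<bullet> x = 0}" convex] convex_hull_vertices[OF P(1)] by (simp add: convex_hyperplane)
      then have "interior P \<subseteq> interior {x. \<alpha> \<bullet> x = 0}" by (rule interior_mono)
      moreover have "\<alpha> \<noteq> 0" using n by auto
      ultimately show False using P(2) interior_hyperplane[of \<alpha> 0] by simp
    qed
    then obtain v where v: "v \<in> ?V" "v \<bullet> \<alpha> \<noteq> 0" by blast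
    define w where "w = reflection \<alpha> v"
    have "w \<in> ?V"
      using extreme_points_linear_image[OF linear_reflection orthogonal_transformation_inj[OF orthogonal_reflection[OF n]], of P] rP v(1)
      by (auto simp: w_def)
    have eq: "v - w = (2 * (v \<bullet> \<alpha>)) *\<^sub>R \<alpha>" "w - v = (2 * - (v \<bullet> \<alpha>)) *\<^sub>R \<alpha>" by (simp_all add: w_def reflection_def)
    have "sgn \<alpha> = \<alpha>" using n by (simp add: sgn_div_norm)
    then have "sgn (v - w) = \<alpha> \<or> sgn (w - v) = \<alpha>"
      using v(2) unfolding eq sgn_scaleR by (cases "0 < v \<bullet> \<alpha>") auto
    then show "\<alpha> \<in> (\<lambda>(v, w). sgn (v - w)) ` (?V \<times> ?V)"
      using v(1) \<open>w \<in> ?V\<close> by force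
  qed
  then show ?thesis using finite_vertices[OF P(1)] by (meson finite_SigmaI finite_imageI finite_subset)
qed

lemma regular_polytope_flag_reflection:
  fixes P :: "'a::euclidean_space set"
  assumes P: "regular_polytope P" "centered_at_origin P" and F: "full_flag P F"
    and k: "k \<in> {1..nat (aff_dim P)}"
  shows "\<exists>g\<in>symmetry_group P. orthogonal_transformation g \<and> g ` F k \<noteq> F k
    \<and> (\<forall>i\<in>{1..nat (aff_dim P)} - {k}. g (vertex_sum (F i)) = vertex_sum (F i))"
proof -
  let ?n = "nat (aff_dim P)"
  have poly: "polytope P" and ne: "P \<noteq> {}" using P(1) by (auto simp: regular_polytope_def)
  obtain H where H: "H \<noteq> F k" "full_flag P (F(k := H))"
    by (rule diamond[OF poly F _ _ ne, of k]) (use k in auto)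
  have "F ` {..Suc ?n} \<in> flags P" "(F(k := H)) ` {..Suc ?n} \<in> flags P"
    using full_flag_in_flags[OF F polytope_imp_convex[OF poly] ne]
      full_flag_in_flags[OF H(2) polytope_imp_convex[OF poly] ne] by blast+
  then obtain g where g: "g \<in> symmetry_group P" and im: "(\<lambda>X. g ` X) ` F ` {..Suc ?n} = (F(k := H)) ` {..Suc ?n}"
    using P(1) unfolding regular_polytope_def by meson
  have orth: "orthogonal_transformation g" by (rule symmetry_group_linear(1)[OF poly ne P(2) g])
  note lin = orthogonal_transformation_linear[OF orth] and inj = orthogonal_transformation_inj[OF orth]
  \<comment> \<open>Regularity matches the two flags only as sets of faces; since \<open>g\<close>
    preserves dimension, it must match them index by index.\<close>
  have gF: "g ` F i = (F(k := H)) i" if i: "i \<le> Suc ?n" for i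
  proof -
    have "g ` F i \<in> (F(k := H)) ` {..Suc ?n}" unfolding im[symmetric] using i by blast
    then obtain j where j: "j \<le> Suc ?n" "g ` F i = (F(k := H)) j" by auto
    have "aff_dim ((F(k := H)) j) = int j - 1" using H(2) j(1) unfolding full_flag_def by blast
    moreover have "aff_dim (g ` F i) = int i - 1" using F i lin inj by (simp add: full_flag_def)
    ultimately have "i = j" using j(2) by simp
    then show ?thesis using j(2) by simp
  qed
  show ?thesis
  proof (intro bexI[OF _ g] conjI orth ballI)
    show "g ` F k \<noteq> F k" using gF[of k] k H(1) by simp
    show "g (vertex_sum (F i)) = vertex_sum (F i)" if "i \<in> {1..?n} - {k}" for i
      using vertex_sum_linear_image[OF lin inj, of "F i"] gF[of i] that by simp
  qed
qed

text \<open>A vector y orthogonal to all roots is fixed by every reflection of P. Writing y as a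
  combination of the vertex sums b i, the reflection belonging to k moves b k alone, so the
  coefficient of b k vanishes. This holds for all k, hence y = 0.\<close>

lemma span_symmetry_roots:
  assumes P: "regular_polytope P" "centered_at_origin P"
  shows "span (symmetry_roots P) = UNIV"
proof (rule ccontr)
  let ?n = "nat (aff_dim P)"
  have poly: "polytope P" and int: "interior P \<noteq> {}" and ne: "P \<noteq> {}" using P(1) by (auto simp: regular_polytope_def)
  obtain F where F: "full_flag P F" using full_flag_exists[OF poly ne] by blast
  define b where "b i = vertex_sum (F i)" for i
  \<comment> \<open>Centering removes the vertex sum of P itself from the spanning family, and this
    is the one vector for which the flag offers no reflection.\<close>
  have "b (Suc ?n) = 0"
    using F P(2) by (simp add: b_def full_flag_def vertex_sum_def centered_at_origin_def)
  moreover have "{1..Suc ?n} = insert (Suc ?n) {1..?n}" by auto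
  ultimately have "span (b ` {1..Suc ?n}) = span (b ` {1..?n})" by (simp only: image_insert span_insert_0)
  moreover have "F (Suc ?n) = P" using F by (simp add: full_flag_def)
  ultimately have "P \<subseteq> span (b ` {1..?n})"
    using full_flag_span[OF poly ne F order_refl, folded b_def] by simp
  then have "span P \<subseteq> span (b ` {1..?n})" by (rule span_minimal) simp
  moreover have "span P = UNIV"
    using affine_hull_nonempty_interior[OF int] affine_hull_subset_span[of P] by auto
  ultimately have span: "span (b ` {1..?n}) = UNIV" by auto
  assume "span (symmetry_roots P) \<noteq> UNIV"
  then obtain y where y: "y \<noteq> 0" "\<And>x. x \<in> span (symmetry_roots P) \<Longrightarrow> y \<bullet> x = 0"
    using span_not_UNIV_orthogonal by blast
  obtain r where r: "y = (\<Sum>i\<in>{1..?n}. r i *\<^sub>R b i)"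
    by (rule span_image_finite_sum[of "{1..?n}" y b]) (use span in auto)
  have "r k = 0" if k: "k \<in> {1..?n}" for k
  proof -
    obtain g where g: "g \<in> symmetry_group P" "orthogonal_transformation g" "g ` F k \<noteq> F k"
      and fixed: "\<forall>i\<in>{1..?n} - {k}. g (b i) = b i"
      using regular_polytope_flag_reflection[OF P F k, folded b_def] by blast
    have lin: "linear g" using g(2) by (rule orthogonal_transformation_linear)
    \<comment> \<open>Otherwise \<open>g\<close> would fix a spanning set and be the identity,
      although it moves the face \<open>F k\<close>.\<close>
    have gb: "g (b k) \<noteq> b k"
    proof
      assume gbk: "g (b k) = b k"
      have "g x = id x" for x
      proof (rule linear_eq_on_span[OF lin linear_id, of "b ` {1..?n}"])
        show "g v = id v" if "v \<in> b ` {1..?n}" for v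
        proof -
          obtain i where "i \<in> {1..?n}" "v = b i" using \<open>v \<in> b ` {1..?n}\<close> by blast
          then show ?thesis using fixed gbk by (cases "i = k") auto
        qed
      qed (use span in simp)
      then have "g ` F k = F k" by simp
      then show False using g(3) by simp
    qed
    have "insert (b k) (b ` ({1..?n} - {k})) = b ` {1..?n}" using k by blast
    then have "span (insert (b k) (b ` ({1..?n} - {k}))) = UNIV" by (simp only: span)
    then have refl: "g = reflection (sgn (b k - g (b k)))"
      by (rule orthogonal_eq_reflection[OF g(2) _ _ gb]) (use fixed in blast)
    have "sgn (b k - g (b k)) \<in> symmetry_roots P"
      unfolding symmetry_roots_def using g(1) gb by (simp add: norm_sgn refl[symmetric])
    then have "y \<bullet> sgn (b k - g (b k)) = 0" using y(2) span_base by blast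
    then have "reflection (sgn (b k - g (b k))) y = y" by (simp add: reflection_def)
    then have "g y = y" by (simp only: refl[symmetric])
    moreover have "g y - y = (\<Sum>i\<in>{1..?n}. r i *\<^sub>R (g (b i) - b i))"
      unfolding r by (simp add: linear_sum[OF lin] linear_scale[OF lin] scaleR_diff_right sum_subtractf)
    moreover have "\<dots> = (\<Sum>i\<in>{k}. r i *\<^sub>R (g (b i) - b i))"
    proof (rule sum.mono_neutral_right)
      show "\<forall>i\<in>{1..?n} - {k}. r i *\<^sub>R (g (b i) - b i) = 0" using fixed by simp
    qed (use k in auto)
    ultimately have "r k *\<^sub>R (g (b k) - b k) = 0" by simp
    then show ?thesis using gb by simp
  qed
  then have "(\<Sum>i\<in>{1..?n}. r i *\<^sub>R b i) = 0" by (intro sum.neutral) simp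
  then show False using y(1) r by simp
qed

lemma root_system_symmetry_roots:
  assumes "regular_polytope P" "centered_at_origin P"
  shows "root_system (symmetry_roots P)"
proof
  show "finite (symmetry_roots P)"
    using assms(1) by (intro finite_symmetry_roots) (simp_all add: regular_polytope_def)
  show "span (symmetry_roots P) = UNIV" using assms by (rule span_symmetry_roots)
  show "norm \<alpha> = 1" if "\<alpha> \<in> symmetry_roots P" for \<alpha> using that by (simp add: symmetry_roots_def)
  show "reflection \<alpha> \<beta> \<in> symmetry_roots P" if ab: "\<alpha> \<in> symmetry_roots P" "\<beta> \<in> symmetry_roots P" for \<alpha> \<beta>
  proof -
    have n: "norm \<alpha> = 1" "norm \<beta> = 1" and r: "reflection \<alpha> \<in> symmetry_group P" "reflection \<beta> \<in> symmetry_group P"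
      using ab by (auto simp: symmetry_roots_def)
    have "norm (reflection \<alpha> \<beta>) = 1"
      using orthogonal_transformation_norm[OF orthogonal_reflection[OF n(1)]] n(2) by simp
    moreover have "reflection (reflection \<alpha> \<beta>) \<in> symmetry_group P"
      unfolding reflection_conjugate[OF n(1)] by (rule symmetry_group_comp[OF r(1) symmetry_group_comp[OF r(2) r(1)]])
    ultimately show ?thesis by (simp add: symmetry_roots_def)
  qed
qed

theorem corollary1:
  fixes P K L :: "(real ^ 'n) set"
    and G :: "(real ^ 'n \<Rightarrow> real ^ 'n) set"
    and t :: real
  assumes "0 < t" and "t < 1"
    and "regular_polytope P" and "centered_at_origin P"
    and "G = symmetry_group P"
    and "convex_body K" and "convex_body L"
    and "invariant_under G K" and "invariant_under G L"
  shows "measure lebesgue (L0_sum t K L)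
           \<ge> measure lebesgue K powr (1 - t) * measure lebesgue L powr t"
proof -
  interpret root_system "symmetry_roots P"
    by (rule root_system_symmetry_roots[OF assms(3,4)])
  have comp: "compact K" "compact L" using assms(6,7) by (simp_all add: convex_body_def)
  have inv: "reflection \<alpha> ` K = K" "reflection \<alpha> ` L = L" if "\<alpha> \<in> symmetry_roots P" for \<alpha>
  proof -
    have "reflection \<alpha> \<in> G" using that by (simp add: assms(5) symmetry_roots_def)
    then show "reflection \<alpha> ` K = K" "reflection \<alpha> ` L = L"
      using assms(8,9) unfolding invariant_under_def by blast+
  qed
  have "measure lborel K powr (1 - t) * measure lborel L powr t \<le> measure lborel (L0_sum t K L)"
    by (rule log_brunn_minkowski[OF assms(1,2) comp(1) inv(1) comp(2) inv(2)])
  \<comment> \<open>All three sets are closed, hence Borel, where the completed measure agrees with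
    \<open>lborel\<close>.\<close>
  moreover have "measure lebesgue S = measure lborel S" if "closed S" for S :: "(real ^ 'n) set"
    using that by (simp add: measure_completion borel_closed)
  ultimately show ?thesis
    using comp by (simp only: compact_imp_closed closed_L0_sum)
qed

end
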